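(* The kernel of the reduced divergence map of species $\mathrm{div}_0\colon\mathrm{RT}\to\mathrm{Cyc}^+(\mathrm{RT})$ is precisely the suboperad $\mathrm{Lie}\subset\mathrm{RT}$.
   Context: All vector spaces are over a field $\Bbbk$ of characteristic zero. A linear species is a functor from finite sets and bijections to vector spaces. Rooted trees are viewed as directed graphs with all edges directed towards the root. $\mathrm{RT}(I)$ is the vector space with basis the rooted trees with vertex set $I$. For $I$ non-empty, a directed cycle of rooted trees on $I$ is a connected directed graph with vertex set $I$ in which every vertex has exactly one outgoing edge (so it has exactly one directed cycle; loops, i.e. cycles of length one, are allowed). $\mathrm{Cyc}(\mathrm{RT})(I)$ is the vector space with basis the directed cycles of rooted trees on $I$, and $\mathrm{Cyc}^+(\mathrm{RT})(I)$ is the span of those whose directed cycle has length at least two. Operad structure on $\mathrm{RT}$ (Chapoton--Livernet): $T_1\circ_\star T_2$ is obtained by replacing the vertex $\star$ of $T_1$ by the tree $T_2$, letting the outgoing edge of $\star$ (if any) start at the root of $T_2$, and summing over all ways to reconnect the incoming edges of $\star$ to vertices of $T_2$. Let $a_1\triangleleft a_2\in\mathrm{RT}(\{1,2\})$ be the tree with root $1$ and an edge from $2$ to $1$. The operation $[a_1,a_2]:=a_1\triangleleft a_2-a_2\triangleleft a_1$ generates a suboperad of $\mathrm{RT}$ isomorphic to the operad of Lie algebras; this is the suboperad denoted $\mathrm{Lie}$. The reduced divergence $\mathrm{div}_0$ sends a rooted tree $T$ to the sum, over all non-root vertices $v$ of $T$, of the directed cycle of rooted trees obtained from $T$ by adding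 an edge directed from the root of $T$ to $v$. *)

theory Defs
  imports "Graph_Theory.Graph_Theory" "HOL-Library.Poly_Mapping" "HOL-Library.FuncSet"
begin

section \<open>Vector spaces with a given basis\<close>

text \<open>
  The vector space over \<open>'k\<close> with basis a set \<open>B :: 'b set\<close> is the set \<open>free_space B\<close> of all
  finitely supported functions \<open>'b \<Rightarrow>\<^sub>0 'k\<close> whose support lies in \<open>B\<close>.
\<close>

definition pm_scale :: "'k \<Rightarrow> ('b \<Rightarrow>\<^sub>0 'k) \<Rightarrow> ('b \<Rightarrow>\<^sub>0 'k::field)" where
  "pm_scale c x = Poly_Mapping.map ((*) c) x"

lemma lookup_pm_scale [simp]:
  "Poly_Mapping.lookup (pm_scale c x) b = c * Poly_Mapping.lookup x b"
  by (simp add: pm_scale_def Poly_Mapping.map.rep_eq when_def)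

global_interpretation pm: vector_space pm_scale
  by unfold_locales (auto intro!: poly_mapping_eqI simp: lookup_add algebra_simps)

abbreviation basis_vec :: "'b \<Rightarrow> ('b \<Rightarrow>\<^sub>0 'k::field)" where
  "basis_vec b \<equiv> Poly_Mapping.single b 1"

definition free_space :: "'b set \<Rightarrow> ('b \<Rightarrow>\<^sub>0 'k::field) set" where
  "free_space B = {x. Poly_Mapping.keys x \<subseteq> B}"

text \<open>The linear extension of a map given on basis elements.\<close>

definition lin_ext :: "('b \<Rightarrow> ('c \<Rightarrow>\<^sub>0 'k)) \<Rightarrow> ('b \<Rightarrow>\<^sub>0 'k) \<Rightarrow> ('c \<Rightarrow>\<^sub>0 'k::field)" where
  "lin_ext f x = (\<Sum>b\<in>Poly_Mapping.keys x. pm_scale (Poly_Mapping.lookup x b) (f b))"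


section \<open>Rooted trees and directed cycles of rooted trees\<close>

text \<open>
  All edges are directed towards the root \<open>r\<close>: from every vertex there is exactly one directed
  walk to \<open>r\<close>.
\<close>

definition is_root :: "'a pair_pre_digraph \<Rightarrow> 'a \<Rightarrow> bool" where
  "is_root T r \<longleftrightarrow>
     r \<in> pverts T \<and> (\<forall>v\<in>pverts T. \<exists>!p. pre_digraph.awalk (with_proj T) v p r)"

definition rooted_tree :: "'a pair_pre_digraph \<Rightarrow> bool" where
  "rooted_tree T \<longleftrightarrow> pair_fin_digraph T \<and> (\<exists>r. is_root T r)"

definition tree_root :: "'a pair_pre_digraph \<Rightarrow> 'a" where
  "tree_root T = (THE r. is_root T r)"

definition rooted_trees :: "'a set \<Rightarrow> 'a pair_pre_digraph set" where
  "rooted_trees I = {T. rooted_tree T \<and> pverts T = I}"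

text \<open>Connectedness in the AFP entry is weak connectedness and includes non-emptiness.\<close>

definition cycles_of_trees :: "'a set \<Rightarrow> 'a pair_pre_digraph set" where
  "cycles_of_trees I =
     {G. pair_fin_digraph G \<and> pverts G = I \<and> connected (with_proj G) \<and>
         (\<forall>v\<in>pverts G. out_degree (with_proj G) v = 1)}"

definition cycles_of_trees_ge2 :: "'a set \<Rightarrow> 'a pair_pre_digraph set" where
  "cycles_of_trees_ge2 I =
     {G \<in> cycles_of_trees I. \<exists>p. pre_digraph.cycle (with_proj G) p \<and> 2 \<le> length p}"


section \<open>The linear species\<close>

text \<open>
  A species is represented by its values on the finite subsets of a label type \<open>'a\<close>, which is
  arbitrary.  All results are to be read for finite index sets only.
\<close>

type_synonym ('a, 'k) graph_vec = "'a pair_pre_digraph \<Rightarrow>\<^sub>0 'k"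

definition RT :: "'a set \<Rightarrow> ('a, 'k::field) graph_vec set" where
  "RT I = free_space (rooted_trees I)"

definition Cyc_RT :: "'a set \<Rightarrow> ('a, 'k::field) graph_vec set" where
  "Cyc_RT I = free_space (cycles_of_trees I)"

definition Cyc_plus_RT :: "'a set \<Rightarrow> ('a, 'k::field) graph_vec set" where
  "Cyc_plus_RT I = free_space (cycles_of_trees_ge2 I)"

definition relabel_graph :: "('a \<Rightarrow> 'a) \<Rightarrow> 'a pair_pre_digraph \<Rightarrow> 'a pair_pre_digraph" where
  "relabel_graph \<sigma> G = \<lparr>pverts = \<sigma> ` pverts G, parcs = map_prod \<sigma> \<sigma> ` parcs G\<rparr>"

definition relabel :: "('a \<Rightarrow> 'a) \<Rightarrow> ('a, 'k::field) graph_vec \<Rightarrow> ('a, 'k) graph_vec" where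
  "relabel \<sigma> = lin_ext (\<lambda>G. basis_vec (relabel_graph \<sigma> G))"


section \<open>The operad structure on rooted trees\<close>

text \<open>
  \<open>graft s T1 T2 f\<close> replaces the vertex \<open>s\<close> of \<open>T1\<close> by the tree \<open>T2\<close>; the incoming edge of \<open>s\<close>
  starting at \<open>u\<close> is reconnected to the vertex \<open>f u\<close> of \<open>T2\<close>.
\<close>

definition graft ::
  "'a \<Rightarrow> 'a pair_pre_digraph \<Rightarrow> 'a pair_pre_digraph \<Rightarrow> ('a \<Rightarrow> 'a) \<Rightarrow> 'a pair_pre_digraph" where
  "graft s T1 T2 f =
     \<lparr>pverts = (pverts T1 - {s}) \<union> pverts T2,
      parcs = {(u, v). (u, v) \<in> parcs T1 \<and> u \<noteq> s \<and> v \<noteq> s} \<union> parcs T2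
            \<union> {(tree_root T2, v) | v. (s, v) \<in> parcs T1}
            \<union> {(u, f u) | u. (u, s) \<in> parcs T1}\<rparr>"

definition compose_trees ::
  "'a \<Rightarrow> 'a pair_pre_digraph \<Rightarrow> 'a pair_pre_digraph \<Rightarrow> ('a, 'k::field) graph_vec" where
  "compose_trees s T1 T2 =
     (\<Sum>f \<in> {u. (u, s) \<in> parcs T1} \<rightarrow>\<^sub>E pverts T2. basis_vec (graft s T1 T2 f))"

definition compose ::
  "'a \<Rightarrow> ('a, 'k::field) graph_vec \<Rightarrow> ('a, 'k) graph_vec \<Rightarrow> ('a, 'k) graph_vec" where
  "compose s x y = lin_ext (\<lambda>T1. lin_ext (\<lambda>T2. compose_trees s T1 T2) y) x"

definition single_vertex :: "'a \<Rightarrow> 'a pair_pre_digraph" where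
  "single_vertex a = \<lparr>pverts = {a}, parcs = {}\<rparr>"

text \<open>
  A suboperad of \<open>RT\<close>.  The partial composition at \<open>s\<close> maps \<open>RT (I \<squnion> {s}) \<otimes> RT J\<close> to
  \<open>RT (I \<squnion> J)\<close>; here \<open>A\<close> is \<open>I \<squnion> {s}\<close>.  The label \<open>s\<close> may occur in \<open>J\<close>, since it disappears from
  \<open>A\<close>; this is what makes the definition meaningful when \<open>'a\<close> is finite, where there need not be a
  label outside \<open>I \<squnion> J\<close>.
\<close>

definition suboperad :: "('a set \<Rightarrow> ('a, 'k::field) graph_vec set) \<Rightarrow> bool" where
  "suboperad P \<longleftrightarrow>
     (\<forall>I. finite I \<longrightarrow> P I \<subseteq> RT I \<and> pm.subspace (P I)) \<and>
     (\<forall>I J \<sigma>. finite I \<longrightarrow> bij_betw \<sigma> I J \<longrightarrow> (\<forall>x\<in>P I. relabel \<sigma> x \<in> P J)) \<and>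
     (\<forall>a. basis_vec (single_vertex a) \<in> P {a}) \<and>
     (\<forall>A J s. finite A \<longrightarrow> finite J \<longrightarrow> s \<in> A \<longrightarrow> (A - {s}) \<inter> J = {} \<longrightarrow>
        (\<forall>x\<in>P A. \<forall>y\<in>P J. compose s x y \<in> P ((A - {s}) \<union> J)))"

definition generated_suboperad ::
  "('a set \<Rightarrow> ('a, 'k::field) graph_vec set) \<Rightarrow> 'a set \<Rightarrow> ('a, 'k) graph_vec set" where
  "generated_suboperad X I = \<Inter>{P I | P. suboperad P \<and> (\<forall>J. X J \<subseteq> P J)}"

text \<open>\<open>two_tree a b\<close> is \<open>a \<triangleleft> b\<close>: the tree with root \<open>a\<close> and an edge from \<open>b\<close> to \<open>a\<close>.\<close>

definition two_tree :: "'a \<Rightarrow> 'a \<Rightarrow> 'a pair_pre_digraph" where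
  "two_tree a b = \<lparr>pverts = {a, b}, parcs = {(b, a)}\<rparr>"

definition bracket :: "'a \<Rightarrow> 'a \<Rightarrow> ('a, 'k::field) graph_vec" where
  "bracket a b = basis_vec (two_tree a b) - basis_vec (two_tree b a)"

text \<open>
  The label type has no distinguished elements \<open>1, 2\<close>, so the generator is taken on every
  two-element set of labels; these are all obtained from any one of them by relabelling.
\<close>

definition Lie :: "'a set \<Rightarrow> ('a, 'k::field) graph_vec set" where
  "Lie = generated_suboperad (\<lambda>J. {bracket a b | a b. a \<noteq> b \<and> J = {a, b}})"


section \<open>The reduced divergence\<close>

definition add_root_arc :: "'a pair_pre_digraph \<Rightarrow> 'a \<Rightarrow> 'a pair_pre_digraph" where
  "add_root_arc T v = \<lparr>pverts = pverts T, parcs = insert (tree_root T, v) (parcs T)\<rparr>"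

definition div0_tree :: "'a pair_pre_digraph \<Rightarrow> ('a, 'k::field) graph_vec" where
  "div0_tree T = (\<Sum>v \<in> pverts T - {tree_root T}. basis_vec (add_root_arc T v))"

definition div0 :: "('a, 'k::field) graph_vec \<Rightarrow> ('a, 'k) graph_vec" where
  "div0 = lin_ext div0_tree"


section \<open>Well-definedness\<close>

text \<open>
  Rooted trees form a suboperad of \<open>RT\<close> in the sense above, so the intersection defining a
  generated suboperad is never over an empty family as long as the generators lie in \<open>RT\<close>; and
  \<open>div0\<close> maps \<open>RT I\<close> to \<open>Cyc_plus_RT I\<close>.
\<close>

lemma awalk_imp_rtrancl:
  "pre_digraph.awalk (with_proj T) u p v \<Longrightarrow> (u, v) \<in> (parcs T)\<^sup>*"
proof -
  have "set p \<subseteq> parcs T \<Longrightarrow> pcas w p v \<Longrightarrow> (w, v) \<in> (parcs T)\<^sup>*" for w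
  proof (induction p arbitrary: w)
    case (Cons e p)
    then have "(w, snd e) \<in> parcs T" "(snd e, v) \<in> (parcs T)\<^sup>*" by (cases e; simp)+
    then show ?case by (rule converse_rtrancl_into_rtrancl)
  qed simp
  then show "pre_digraph.awalk (with_proj T) u p v \<Longrightarrow> (u, v) \<in> (parcs T)\<^sup>*"
    by (simp add: pre_digraph.awalk_def cas_with_proj_eq)
qed

lemma (in pair_wf_digraph) rtrancl_imp_awalk:
  assumes "(u, v) \<in> (parcs G)\<^sup>*" "v \<in> pverts G"
  shows "u \<in> pverts G \<and> (\<exists>p. awalk u p v)"
  using assms
proof (induction rule: converse_rtrancl_induct)
  case base
  then show ?case by (auto intro!: exI[of _ "[]"] simp: awalk_Nil_iff)
next
  case (step y z)
  then obtain p where "awalk z p v" by blast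
  then have "awalk y ((y, z) # p) v" using step by (auto simp: awalk_Cons_iff)
  then show ?case using step in_arcsD1 by blast
qed

lemma is_root_iff:
  assumes "pair_wf_digraph T"
  shows "is_root T r \<longleftrightarrow> r \<in> pverts T \<and> (\<forall>v. (r, v) \<notin> parcs T) \<and>
     (\<forall>v\<in>pverts T. (v, r) \<in> (parcs T)\<^sup>*) \<and>
     (\<forall>u v w. (u, v) \<in> parcs T \<longrightarrow> (u, w) \<in> parcs T \<longrightarrow> v = w)" (is "_ \<longleftrightarrow> ?R")
proof
  interpret pair_wf_digraph T by fact
  assume a: "is_root T r"
  then have r: "r \<in> pverts T" and ex: "\<And>v. v \<in> pverts T \<Longrightarrow> \<exists>!p. awalk v p r"
    by (auto simp: is_root_def)
  have reach: "(v, r) \<in> (parcs T)\<^sup>*" if v: "v \<in> pverts T" for v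
  proof -
    obtain p where "awalk v p r" using ex[OF v] by (elim ex1E)
    then show ?thesis by (rule awalk_imp_rtrancl)
  qed
  have uniq: "p = q" if "awalk v p r" "awalk v q r" for v p q
  proof -
    have "v \<in> pverts T" using that(1) by (simp add: awalk_def)
    from ex[OF this] that show ?thesis by blast
  qed
  have cons: "\<exists>p. awalk u ((u, v) # p) r" if uv: "(u, v) \<in> parcs T" for u v
  proof -
    obtain p where "awalk v p r" using ex[OF in_arcsD2[OF uv]] by (elim ex1E)
    then have "awalk u ((u, v) # p) r" using uv in_arcsD1 by (simp add: awalk_Cons_iff)
    then show ?thesis ..
  qed
  have out: "(r, v) \<notin> parcs T" for v
  proof
    assume "(r, v) \<in> parcs T"
    then obtain p where "awalk r ((r, v) # p) r" using cons by blast
    moreover have "awalk r [] r" using r by (simp add: awalk_Nil_iff)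
    ultimately show False using uniq by blast
  qed
  have det: "v = w" if uv: "(u, v) \<in> parcs T" and uw: "(u, w) \<in> parcs T" for u v w
  proof -
    obtain p q where "awalk u ((u, v) # p) r" "awalk u ((u, w) # q) r"
      using cons[OF uv] cons[OF uw] by blast
    then have "(u, v) # p = (u, w) # q" by (rule uniq)
    then show ?thesis by simp
  qed
  show ?R by (intro conjI allI ballI impI) (fact r, fact out, fact reach, fact det)
next
  interpret pair_wf_digraph T by fact
  assume R: ?R
  then have out: "\<And>v. (r, v) \<notin> parcs T" and rV: "r \<in> pverts T"
    and reach: "\<And>v. v \<in> pverts T \<Longrightarrow> (v, r) \<in> (parcs T)\<^sup>*"
    and det: "\<And>u v w. (u, v) \<in> parcs T \<Longrightarrow> (u, w) \<in> parcs T \<Longrightarrow> v = w"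
    by (elim conjE; blast)+
  have uniq: "p = q" if "awalk v p r" "awalk v q r" for v p q
    using that
  proof (induction p arbitrary: v q)
    case Nil
    then show ?case using out by (cases q) (auto simp: awalk_Nil_iff awalk_Cons_iff)
  next
    case (Cons e p)
    then have e: "e \<in> parcs T" "fst e = v" "awalk (snd e) p r" by (auto simp: awalk_Cons_iff)
    then have "v \<noteq> r" using out[of "snd e"] by (cases e) auto
    with Cons.prems(2) obtain e' q' where q: "q = e' # q'"
      by (cases q) (auto simp: awalk_Nil_iff)
    with Cons.prems(2) have e': "e' \<in> parcs T" "fst e' = v" "awalk (snd e') q' r"
      by (auto simp: awalk_Cons_iff)
    have "snd e = snd e'" using det[of v "snd e" "snd e'"] e(1,2) e'(1,2) by (cases e; cases e') auto
    moreover from this have "e = e'" using e(2) e'(2) by (simp add: prod_eq_iff)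
    ultimately show ?case using q e(3) e'(3) Cons.IH by auto
  qed
  have "\<exists>p. awalk v p r" if "v \<in> pverts T" for v
    using rtrancl_imp_awalk[OF reach[OF that] rV] by blast
  then have "\<exists>!p. awalk v p r" if "v \<in> pverts T" for v
    using that by (intro ex_ex1I) (auto intro: uniq)
  then show "is_root T r" using rV unfolding is_root_def by simp
qed

lemma is_root_unique:
  assumes "pair_wf_digraph T" "is_root T r" "is_root T r'"
  shows "r = r'"
proof -
  have "(r, r') \<in> (parcs T)\<^sup>*" using assms by (auto simp: is_root_iff)
  then show ?thesis using assms by (cases rule: converse_rtranclE) (auto simp: is_root_iff)
qed

lemma rooted_treeD:
  assumes "rooted_tree T"
  shows "pair_fin_digraph T" "pair_wf_digraph T" "is_root T (tree_root T)"
proof -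
  show 1: "pair_fin_digraph T" using assms by (simp add: rooted_tree_def)
  then interpret pair_fin_digraph T .
  show 2: "pair_wf_digraph T" ..
  show "is_root T (tree_root T)"
  proof -
    obtain r where r: "is_root T r" using assms by (auto simp: rooted_tree_def)
    then show ?thesis unfolding tree_root_def by (rule theI) (rule is_root_unique[OF 2 _ r])
  qed
qed

lemma root_eqI: "pair_wf_digraph T \<Longrightarrow> is_root T r \<Longrightarrow> tree_root T = r"
  unfolding tree_root_def by (rule the_equality) (auto dest: is_root_unique)

lemma is_root_graft:
  assumes T1: "rooted_tree T1" and T2: "rooted_tree T2" and s: "s \<in> pverts T1"
    and disj: "(pverts T1 - {s}) \<inter> pverts T2 = {}"
    and f: "f \<in> {u. (u, s) \<in> parcs T1} \<rightarrow>\<^sub>E pverts T2"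
  defines "G \<equiv> graft s T1 T2 f"
  defines "\<rho> \<equiv> (if tree_root T1 = s then tree_root T2 else tree_root T1)"
  shows "pair_fin_digraph G" "is_root G \<rho>"
proof -
  interpret T1: pair_fin_digraph T1 using T1 by (rule rooted_treeD)
  interpret T2: pair_fin_digraph T2 using T2 by (rule rooted_treeD)
  note wf1 = T1.pair_wf_digraph_axioms and wf2 = T2.pair_wf_digraph_axioms
  note R1 = rooted_treeD(3)[OF T1, unfolded is_root_iff[OF wf1]]
  note R2 = rooted_treeD(3)[OF T2, unfolded is_root_iff[OF wf2]]
  note in1 = T1.in_arcsD1 T1.in_arcsD2 and in2 = T2.in_arcsD1 T2.in_arcsD2
  have fV: "f u \<in> pverts T2" if "(u, s) \<in> parcs T1" for u using f that by (auto simp: PiE_def Pi_def)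
  have V: "pverts G = (pverts T1 - {s}) \<union> pverts T2" by (simp add: G_def graft_def)
  have E: "parcs G = {(u, v). (u, v) \<in> parcs T1 \<and> u \<noteq> s \<and> v \<noteq> s} \<union> parcs T2
            \<union> {(tree_root T2, v) | v. (s, v) \<in> parcs T1}
            \<union> {(u, f u) | u. (u, s) \<in> parcs T1}" by (simp add: G_def graft_def)
  have noloop: "u \<noteq> v" if "(u, v) \<in> parcs T1" for u v
  proof
    assume "u = v"
    with that R1 have only: "\<And>w. (u, w) \<in> parcs T1 \<Longrightarrow> w = u" by blast
    have "(u, tree_root T1) \<in> (parcs T1)\<^sup>*" using R1 in1 that by blast
    then have "tree_root T1 = u" by (induction rule: rtrancl_induct) (use only in auto)
    with that R1 show False by blast
  qed
  have wfE: "u \<in> pverts G \<and> v \<in> pverts G" if "(u, v) \<in> parcs G" for u v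
  proof -
    have "(s, s) \<notin> parcs T1" using noloop by blast
    moreover have "tree_root T2 \<in> pverts T2" using R2 by blast
    ultimately show ?thesis
      using that in1 in2 fV unfolding V E by (auto dest: in1 in2)
  qed
  have sub: "parcs G \<subseteq> pverts G \<times> pverts G" using wfE by auto
  have finV: "finite (pverts G)" unfolding V using T1.pair_finite_verts T2.pair_finite_verts by simp
  show fin: "pair_fin_digraph G"
    using wfE finV finite_subset[OF sub] by unfold_locales auto
  then interpret G: pair_fin_digraph G .
  have rV: "\<rho> \<in> pverts G" using R1 R2 by (auto simp: \<rho>_def V)
  have ss: "(s, s) \<notin> parcs T1" using noloop by blast
  have Ecases: "(u, x) \<in> parcs T1 \<and> u \<noteq> s \<and> x \<noteq> s \<or> (u, x) \<in> parcs T2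
      \<or> u = tree_root T2 \<and> (s, x) \<in> parcs T1 \<or> (u, s) \<in> parcs T1 \<and> x = f u"
    if "(u, x) \<in> parcs G" for u x
    using that by (auto simp: E)
  have out1: "(tree_root T1, v) \<notin> parcs T1" and out2: "(tree_root T2, v) \<notin> parcs T2" for v
    using R1 R2 by blast+
  have r1: "tree_root T1 \<in> pverts T1" and r2: "tree_root T2 \<in> pverts T2" using R1 R2 by blast+
  have det1: "v = w" if "(u, v) \<in> parcs T1" "(u, w) \<in> parcs T1" for u v w
    using R1 that by blast
  have det2: "v = w" if "(u, v) \<in> parcs T2" "(u, w) \<in> parcs T2" for u v w
    using R2 that by blast
  have T2arc: "(u, x) \<in> parcs T2 \<or> u = tree_root T2 \<and> (s, x) \<in> parcs T1"
    if "u \<in> pverts T2" "(u, x) \<in> parcs G" for u x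
  proof -
    have "u = s" if "(u, w) \<in> parcs T1" for w using that in1(1) disj \<open>u \<in> pverts T2\<close> by blast
    then show ?thesis using Ecases[OF that(2)] ss by blast
  qed
  have T1arc: "(u, x) \<in> parcs T1 \<and> x \<noteq> s \<or> (u, s) \<in> parcs T1 \<and> x = f u"
    if "u \<notin> pverts T2" "(u, x) \<in> parcs G" for u x
    using Ecases[OF that(2)] that(1) in2(1) r2 by blast
  have out: "(\<rho>, v) \<notin> parcs G" for v
  proof (cases "tree_root T1 = s")
    case True
    then show ?thesis using T2arc[OF r2] out1 out2 by (auto simp: \<rho>_def)
  next
    case False
    with disj r1 have "tree_root T1 \<notin> pverts T2" by blast
    then show ?thesis using T1arc out1 False by (auto simp: \<rho>_def)
  qed
  have det: "v = w" if "(u, v) \<in> parcs G" "(u, w) \<in> parcs G" for u v w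
  proof (cases "u \<in> pverts T2")
    case True
    show ?thesis using T2arc[OF True that(1)] T2arc[OF True that(2)] det1 det2 out2 by blast
  next
    case False
    show ?thesis using T1arc[OF False that(1)] T1arc[OF False that(2)] det1 by blast
  qed
  have sub2: "parcs T2 \<subseteq> parcs G" by (auto simp: E)
  have to2: "(v, tree_root T2) \<in> (parcs G)\<^sup>*" if "v \<in> pverts T2" for v
    using R2 that rtrancl_mono[OF sub2] by blast
  have main: "if v = s then (\<forall>u\<in>pverts T2. (u, \<rho>) \<in> (parcs G)\<^sup>*) else (v, \<rho>) \<in> (parcs G)\<^sup>*"
    if "v \<in> pverts T1" for v
  proof -
    have "(v, tree_root T1) \<in> (parcs T1)\<^sup>*" using R1 that by blast
    then show ?thesis
    proof (induction rule: converse_rtrancl_induct)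
      case base
      then show ?case using to2 by (auto simp: \<rho>_def)
    next
      case (step y z)
      show ?case
      proof (cases "y = s")
        case True
        with step noloop have "z \<noteq> s" by blast
        then have "(tree_root T2, z) \<in> parcs G" "(z, \<rho>) \<in> (parcs G)\<^sup>*" using step True by (auto simp: E)
        then show ?thesis using True to2
          by (auto intro: rtrancl_trans converse_rtrancl_into_rtrancl)
      next
        case False
        show ?thesis
        proof (cases "z = s")
          case True
          then have "(y, f y) \<in> parcs G" "f y \<in> pverts T2" using step fV by (auto simp: E)
          then show ?thesis using False True step.IH by (auto intro: converse_rtrancl_into_rtrancl)
        next
          case z: False
          then have "(y, z) \<in> parcs G" using False step by (auto simp: E)
          then show ?thesis using False z step.IH by (auto intro: converse_rtrancl_into_rtrancl)
        qed
      qed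
    qed
  qed
  have "(v, \<rho>) \<in> (parcs G)\<^sup>*" if "v \<in> pverts G" for v
    using that main[of v] main[of s] s unfolding V by (auto split: if_splits)
  then show "is_root G \<rho>"
    unfolding is_root_iff[OF G.pair_wf_digraph_axioms] using rV out det by blast
qed

lemma free_space_subspace: "pm.subspace (free_space B :: ('b \<Rightarrow>\<^sub>0 'k::field) set)"
proof -
  have "(free_space B :: ('b \<Rightarrow>\<^sub>0 'k) set) = {x. \<forall>b. b \<notin> B \<longrightarrow> Poly_Mapping.lookup x b = 0}"
    by (auto simp: free_space_def in_keys_iff)
  then show ?thesis by (simp add: pm.subspace_def lookup_add)
qed

lemma basis_vec_in_free_space: "b \<in> B \<Longrightarrow> basis_vec b \<in> free_space B"
  by (simp add: free_space_def)

lemma lin_ext_in: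
  assumes "pm.subspace S" "x \<in> free_space B" "\<And>b. b \<in> B \<Longrightarrow> f b \<in> S"
  shows "lin_ext f x \<in> S"
  unfolding lin_ext_def
proof (rule pm.subspace_sum[OF assms(1)])
  fix b assume "b \<in> Poly_Mapping.keys x"
  then have "b \<in> B" using assms(2) by (auto simp: free_space_def)
  then show "pm_scale (Poly_Mapping.lookup x b) (f b) \<in> S"
    by (intro pm.subspace_scale[OF assms(1)] assms(3))
qed

lemma relabel_rooted:
  assumes T: "T \<in> rooted_trees I" and \<sigma>: "bij_betw \<sigma> I J"
  shows "relabel_graph \<sigma> T \<in> rooted_trees J"
proof -
  have tr: "rooted_tree T" and V: "pverts T = I" using T by (auto simp: rooted_trees_def)
  interpret pair_fin_digraph T using tr by (rule rooted_treeD)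
  let ?G = "relabel_graph \<sigma> T"
  note R = rooted_treeD(3)[OF tr, unfolded is_root_iff[OF pair_wf_digraph_axioms]]
  have inj: "x = y" if "\<sigma> x = \<sigma> y" "x \<in> I" "y \<in> I" for x y
    using that \<sigma> by (auto simp: bij_betw_def inj_on_def)
  have VG: "pverts ?G = J" using \<sigma> V by (auto simp: relabel_graph_def bij_betw_def)
  have E: "(u, v) \<in> parcs ?G \<longleftrightarrow> (\<exists>a b. (a, b) \<in> parcs T \<and> u = \<sigma> a \<and> v = \<sigma> b)" for u v
    by (force simp: relabel_graph_def)
  interpret G: pair_fin_digraph ?G
  proof unfold_locales
    show "finite (pverts ?G)" "finite (parcs ?G)"
      using pair_finite_verts pair_finite_arcs by (auto simp: relabel_graph_def)
  qed (use in_arcsD1 in_arcsD2 in \<open>auto simp: relabel_graph_def\<close>)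
  have reach: "(\<sigma> a, \<sigma> b) \<in> (parcs ?G)\<^sup>*" if "(a, b) \<in> (parcs T)\<^sup>*" for a b
    using that
  proof (induction rule: rtrancl_induct)
    case (step y z)
    then have "(\<sigma> y, \<sigma> z) \<in> parcs ?G" unfolding E by blast
    with step show ?case by (meson rtrancl_into_rtrancl)
  qed simp
  have "is_root ?G (\<sigma> (tree_root T))"
    unfolding is_root_iff[OF G.pair_wf_digraph_axioms]
  proof (intro conjI allI ballI impI)
    show "\<sigma> (tree_root T) \<in> pverts ?G" using R by (auto simp: relabel_graph_def)
    show "(\<sigma> (tree_root T), v) \<notin> parcs ?G" for v
    proof
      assume "(\<sigma> (tree_root T), v) \<in> parcs ?G"
      then obtain a b where "(a, b) \<in> parcs T" "\<sigma> (tree_root T) = \<sigma> a" unfolding E by blast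
      moreover from this have "tree_root T = a" using inj R in_arcsD1 V by blast
      ultimately show False using R by blast
    qed
    show "(v, \<sigma> (tree_root T)) \<in> (parcs ?G)\<^sup>*" if "v \<in> pverts ?G" for v
      using that reach R by (auto simp: relabel_graph_def)
    show "v = w" if "(u, v) \<in> parcs ?G" "(u, w) \<in> parcs ?G" for u v w
    proof -
      obtain a b where 1: "(a, b) \<in> parcs T" "u = \<sigma> a" "v = \<sigma> b"
        using \<open>(u, v) \<in> parcs ?G\<close> unfolding E by blast
      obtain a' b' where 2: "(a', b') \<in> parcs T" "u = \<sigma> a'" "w = \<sigma> b'"
        using \<open>(u, w) \<in> parcs ?G\<close> unfolding E by blast
      note * = 1 2
      then have "a = a'" using inj in_arcsD1 V by metis
      then show ?thesis using * R by blast
    qed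
  qed
  then show ?thesis using VG G.pair_fin_digraph_axioms by (auto simp: rooted_trees_def rooted_tree_def)
qed

lemma suboperad_RT: "suboperad (RT :: 'a set \<Rightarrow> ('a, 'k::field) graph_vec set)"
  unfolding suboperad_def
proof (intro conjI allI impI ballI)
  fix I :: "'a set"
  show "pm.subspace (RT I :: ('a, 'k) graph_vec set)"
    unfolding RT_def by (rule free_space_subspace)
next
  fix I J :: "'a set" and \<sigma> and x :: "('a, 'k) graph_vec"
  assume \<sigma>: "bij_betw \<sigma> I J" and x: "x \<in> RT I"
  show "relabel \<sigma> x \<in> RT J"
    unfolding RT_def relabel_def
    by (rule lin_ext_in[OF free_space_subspace x[unfolded RT_def]])
      (intro basis_vec_in_free_space relabel_rooted[OF _ \<sigma>])
next
  fix a :: 'a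
  have wf: "pair_fin_digraph (single_vertex a)" by unfold_locales (auto simp: single_vertex_def)
  then interpret pair_fin_digraph "single_vertex a" .
  have "is_root (single_vertex a) a"
    unfolding is_root_iff[OF pair_wf_digraph_axioms] by (auto simp: single_vertex_def)
  then have "rooted_tree (single_vertex a)" using wf unfolding rooted_tree_def by blast
  then have "single_vertex a \<in> rooted_trees {a}"
    by (simp add: rooted_trees_def) (simp add: single_vertex_def)
  then show "(basis_vec (single_vertex a) :: ('a, 'k) graph_vec) \<in> RT {a}"
    unfolding RT_def by (rule basis_vec_in_free_space)
next
  fix A J :: "'a set" and s and x y :: "('a, 'k) graph_vec"
  assume *: "s \<in> A" "(A - {s}) \<inter> J = {}" "x \<in> RT A" "y \<in> RT J"
  have 3: "(basis_vec (graft s T1 T2 f) :: ('a, 'k) graph_vec) \<in> free_space (rooted_trees (A - {s} \<union> J))"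
    if "T1 \<in> rooted_trees A" "T2 \<in> rooted_trees J"
      "f \<in> {u. (u, s) \<in> parcs T1} \<rightarrow>\<^sub>E pverts T2" for T1 T2 f
  proof -
    have 1: "rooted_tree T1" "rooted_tree T2" "pverts T1 = A" "pverts T2 = J"
      using that by (simp_all add: rooted_trees_def)
    then have "s \<in> pverts T1" "(pverts T1 - {s}) \<inter> pverts T2 = {}" using * by simp_all
    note G = is_root_graft[OF 1(1,2) this that(3)]
    have "rooted_tree (graft s T1 T2 f)"
      unfolding rooted_tree_def using G by (intro conjI exI)
    moreover have "pverts (graft s T1 T2 f) = A - {s} \<union> J" using 1 by (simp add: graft_def)
    ultimately show ?thesis by (simp add: basis_vec_in_free_space rooted_trees_def)
  qed
  have 2: "(compose_trees s T1 T2 :: ('a, 'k) graph_vec) \<in> free_space (rooted_trees (A - {s} \<union> J))"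
    if "T1 \<in> rooted_trees A" "T2 \<in> rooted_trees J" for T1 T2
    unfolding compose_trees_def by (intro pm.subspace_sum[OF free_space_subspace] 3 that)
  show "compose s x y \<in> RT (A - {s} \<union> J)"
    unfolding RT_def compose_def
    by (rule lin_ext_in[OF free_space_subspace *(3)[unfolded RT_def]],
        rule lin_ext_in[OF free_space_subspace *(4)[unfolded RT_def]]) (rule 2)
qed (rule subset_refl)

lemma add_root_arc_cycle:
  assumes T: "T \<in> rooted_trees I" and v: "v \<in> I - {tree_root T}"
  shows "add_root_arc T v \<in> cycles_of_trees_ge2 I"
proof -
  have tr: "rooted_tree T" and V: "pverts T = I" using T by (auto simp: rooted_trees_def)
  interpret pair_fin_digraph T using tr by (rule rooted_treeD)
  let ?G = "add_root_arc T v" and ?r = "tree_root T"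
  note R = rooted_treeD(3)[OF tr, unfolded is_root_iff[OF pair_wf_digraph_axioms]]
  have VG: "pverts ?G = I" and E: "parcs ?G = insert (?r, v) (parcs T)"
    using V by (auto simp: add_root_arc_def)
  have rV: "?r \<in> pverts T" and rout: "\<And>w. (?r, w) \<notin> parcs T"
    and det: "\<And>u w w'. (u, w) \<in> parcs T \<Longrightarrow> (u, w') \<in> parcs T \<Longrightarrow> w = w'"
    and reach: "\<And>u. u \<in> I \<Longrightarrow> (u, ?r) \<in> (parcs T)\<^sup>*"
    using R V by blast+
  interpret G: pair_fin_digraph ?G
  proof unfold_locales
    fix e assume "e \<in> parcs ?G"
    then show "fst e \<in> pverts ?G" "snd e \<in> pverts ?G"
      using in_arcsD1 in_arcsD2 rV v V unfolding E VG by (cases e; auto)+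
  qed (use pair_finite_verts pair_finite_arcs V VG E in simp_all)
  have "out_degree (with_proj ?G) u = 1" if u: "u \<in> I" for u
  proof -
    have "\<exists>w. out_arcs (with_proj ?G) u = {(u, w)}"
    proof (cases "u = ?r")
      case True
      then have "out_arcs (with_proj ?G) u = {(u, v)}"
        using rout unfolding out_arcs_def by (auto simp: E)
      then show ?thesis ..
    next
      case False
      then obtain w where "(u, w) \<in> parcs T" using reach[OF u] by (metis converse_rtranclE)
      then have "out_arcs (with_proj ?G) u = {(u, w)}"
        using False det unfolding out_arcs_def by (auto simp: E)
      then show ?thesis ..
    qed
    then show ?thesis by (auto simp: out_degree_def)
  qed
  moreover have "connected (with_proj ?G)"
    unfolding connected_def strongly_connected_def
  proof (intro conjI ballI)
    let ?S = "mk_symmetric (with_proj ?G)"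
    have SE: "parcs ?S = parcs ?G \<union> (parcs ?G)\<inverse>" by (auto simp: mk_symmetric_def)
    have SV: "pverts ?S = I" using VG by (simp add: mk_symmetric_def)
    interpret S: pair_wf_digraph ?S
      using G.in_arcsD1 G.in_arcsD2 by unfold_locales (auto simp: mk_symmetric_def)
    show "verts (with_proj ?S) \<noteq> {}" using SV v by auto
    fix a b assume "a \<in> verts (with_proj ?S)" "b \<in> verts (with_proj ?S)"
    then have ab: "a \<in> I" "b \<in> I" using SV by auto
    have "parcs T \<subseteq> parcs ?S" unfolding SE E by blast
    then have "(parcs T)\<^sup>* \<subseteq> (parcs ?S)\<^sup>*" by (rule rtrancl_mono)
    then have 1: "(a, ?r) \<in> (parcs ?S)\<^sup>*" and 2: "(b, ?r) \<in> (parcs ?S)\<^sup>*"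
      using reach ab by blast+
    have "sym ((parcs ?S)\<^sup>*)" unfolding SE by (intro sym_rtrancl sym_Un_converse)
    then have "(?r, b) \<in> (parcs ?S)\<^sup>*" using 2 by (rule symD)
    with 1 have "(a, b) \<in> (parcs ?S)\<^sup>*" by simp
    then obtain p where "S.awalk a p b" using S.rtrancl_imp_awalk[of a b] ab SV by auto
    then show "a \<rightarrow>\<^sup>*\<^bsub>with_proj ?S\<^esub> b" using S.reachable_awalk by blast
  qed
  moreover have "\<exists>p. pre_digraph.cycle (with_proj ?G) p \<and> 2 \<le> length p"
  proof -
    obtain p0 where "awalk v p0 ?r" using rtrancl_imp_awalk[of v ?r] reach rV v by blast
    then obtain p where p: "apath v p ?r" using apath_awalk_to_apath by blast
    then have aw: "awalk v p ?r" and d: "distinct (pawalk_verts v p)" by (auto simp: apath_def)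
    have "p \<noteq> []" using aw v by (auto simp: awalk_Nil_iff)
    moreover have "G.awalk ?r ((?r, v) # p) ?r"
      using aw VG V rV by (auto simp: awalk_def G.awalk_def E)
    moreover have "distinct (tl (pawalk_verts ?r ((?r, v) # p)))" using d by simp
    ultimately show ?thesis unfolding G.cycle_def
      by (intro exI[of _ "(?r, v) # p"]) (auto simp: Suc_le_eq)
  qed
  ultimately show ?thesis using VG G.pair_fin_digraph_axioms
    by (auto simp: cycles_of_trees_ge2_def cycles_of_trees_def)
qed

lemma div0_in_Cyc_plus_RT: "x \<in> RT I \<Longrightarrow> div0 x \<in> Cyc_plus_RT I"
  unfolding RT_def Cyc_plus_RT_def div0_def
proof (erule lin_ext_in[OF free_space_subspace])
  fix T :: "'a pair_pre_digraph" assume T: "T \<in> rooted_trees I"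
  then have "pverts T = I" by (simp add: rooted_trees_def)
  then show "div0_tree T \<in> free_space (cycles_of_trees_ge2 I)"
    unfolding div0_tree_def
    by (intro pm.subspace_sum[OF free_space_subspace] basis_vec_in_free_space
        add_root_arc_cycle[OF T]) simp
qed

end

theory Submission
  imports Defs
begin

text \<open>
  For trees \<open>T1\<close>, \<open>T2\<close> one has \<open>div0 (T1 \<circ>\<^sub>s T2) = div0 T1 \<circ>\<^sub>s T2\<close>, plus \<open>T1 \<circ>\<^sub>s div0 T2\<close> if \<open>s\<close> is the
  root of \<open>T1\<close>; hence the kernel is a suboperad, and it contains the brackets.

  Conversely, let \<open>x\<close> be in the kernel and consider the coefficients of \<open>div0 x\<close> at graphs with a short
  cycle.  Two-cycles show that the coefficients of \<open>x\<close> change sign when the root moves across an edge.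
  Together with this, three-cycles show that if the root has two children \<open>p\<close>, \<open>q\<close>, then the coefficient
  is the sum of those of the two trees where \<open>q\<close> is moved to \<open>p\<close>, respectively \<open>p\<close> to \<open>q\<close>.  Fixing a
  vertex \<open>a\<close>, these relations express all coefficients of \<open>x\<close> through those at the chains leading from
  the leaf \<open>a\<close> to the root.  The iterated brackets \<open>[b\<^sub>1, [b\<^sub>2, \<dots>, [b\<^sub>k, a]]]\<close> are dual to these
  chains, so \<open>x\<close> is a linear combination of them.
\<close>

section \<open>Linear extensions\<close>

lemma lin_ext_superset:
  assumes "finite B" "Poly_Mapping.keys x \<subseteq> B"
  shows "lin_ext f x = (\<Sum>b\<in>B. pm_scale (Poly_Mapping.lookup x b) (f b))"
  unfolding lin_ext_def
  by (rule sum.mono_neutral_left) (use assms in \<open>auto simp: in_keys_iff\<close>)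

lemma lin_ext_add: "lin_ext f (x + y) = lin_ext f x + lin_ext f y"
proof -
  let ?B = "Poly_Mapping.keys x \<union> Poly_Mapping.keys y"
  have "lin_ext f z = (\<Sum>b\<in>?B. pm_scale (Poly_Mapping.lookup z b) (f b))"
    if "Poly_Mapping.keys z \<subseteq> ?B" for z
    using that by (intro lin_ext_superset) auto
  then show ?thesis
    using Poly_Mapping.keys_add[of x y]
    by (simp add: lookup_add pm.scale_left_distrib sum.distrib)
qed

lemma lin_ext_scale: "lin_ext f (pm_scale c x) = pm_scale c (lin_ext f x)"
proof -
  have "lin_ext f (pm_scale c x) =
      (\<Sum>b\<in>Poly_Mapping.keys x. pm_scale (Poly_Mapping.lookup (pm_scale c x) b) (f b))"
    by (intro lin_ext_superset) (auto simp: in_keys_iff)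
  then show ?thesis by (simp add: lin_ext_def pm.scale_sum_right)
qed

lemma lin_ext_zero [simp]: "lin_ext f 0 = 0"
  by (simp add: lin_ext_def)

lemma lin_ext_diff: "lin_ext f (x - y) = lin_ext f x - lin_ext f y"
  using lin_ext_add[of f "x - y" y] by (simp add: algebra_simps)

lemma lin_ext_sum: "lin_ext f (sum g A) = (\<Sum>a\<in>A. lin_ext f (g a))"
  by (induction A rule: infinite_finite_induct) (simp_all add: lin_ext_add)

lemma lin_ext_basis_vec [simp]: "lin_ext f (basis_vec b) = f b"
  by (simp add: lin_ext_def)

lemma lin_ext_lin_ext: "lin_ext g (lin_ext f x) = lin_ext (\<lambda>b. lin_ext g (f b)) x"
  by (simp add: lin_ext_def[of f] lin_ext_def[of "\<lambda>b. lin_ext g (f b)"] lin_ext_sum lin_ext_scale)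

lemma lin_ext_cong:
  assumes "x \<in> free_space B" "\<And>b. b \<in> B \<Longrightarrow> f b = g b"
  shows "lin_ext f x = lin_ext g x"
  unfolding lin_ext_def by (rule sum.cong) (use assms in \<open>auto simp: free_space_def\<close>)

lemma lin_ext_fun_add: "lin_ext (\<lambda>b. f b + g b) x = lin_ext f x + lin_ext g x"
  by (simp add: lin_ext_def pm.scale_right_distrib sum.distrib)

lemma lin_ext_fun_zero [simp]: "lin_ext (\<lambda>b. 0) x = 0"
  by (simp add: lin_ext_def)

text \<open>Interchange of two finite sums. As \<open>compose\<close> sums over its first argument
  outside, this gives access to linearity in the other order.\<close>

lemma lin_ext_swap:
  "lin_ext (\<lambda>b. lin_ext (\<lambda>c. h b c) y) x = lin_ext (\<lambda>c. lin_ext (\<lambda>b. h b c) x) y"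
  unfolding lin_ext_def pm.scale_sum_right
  by (subst sum.swap) (simp add: mult.commute)

lemma lookup_lin_ext:
  "Poly_Mapping.lookup (lin_ext f x) c =
    (\<Sum>b\<in>Poly_Mapping.keys x. Poly_Mapping.lookup x b * Poly_Mapping.lookup (f b) c)"
  by (simp add: lin_ext_def lookup_sum)

section \<open>Rooted trees as sets of arcs\<close>

text \<open>Unique walks to the root are replaced by reachability together with single-valued arcs
  and no arc out of the root. The root is a parameter instead of a definite description, so that a
  tree with changed arcs can be checked directly.\<close>

definition rtree :: "'a set \<Rightarrow> 'a \<Rightarrow> ('a \<times> 'a) set \<Rightarrow> bool" where
  "rtree I r E \<longleftrightarrow> finite I \<and> E \<subseteq> I \<times> I \<and> r \<in> I \<and> (\<forall>v. (r, v) \<notin> E) \<and>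
     (\<forall>u v w. (u, v) \<in> E \<longrightarrow> (u, w) \<in> E \<longrightarrow> v = w) \<and> (\<forall>v\<in>I. (v, r) \<in> E\<^sup>*)"

abbreviation digraph_of :: "'a set \<Rightarrow> ('a \<times> 'a) set \<Rightarrow> 'a pair_pre_digraph" where
  "digraph_of I E \<equiv> \<lparr>pverts = I, parcs = E\<rparr>"

lemma rtreeI:
  assumes "finite I" "E \<subseteq> I \<times> I" "r \<in> I" "\<And>v. (r, v) \<notin> E"
    "\<And>u v w. (u, v) \<in> E \<Longrightarrow> (u, w) \<in> E \<Longrightarrow> v = w" "\<And>v. v \<in> I \<Longrightarrow> (v, r) \<in> E\<^sup>*"
  shows "rtree I r E"
  using assms unfolding rtree_def by blast

lemma rtreeD:
  assumes "rtree I r E"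
  shows "finite I" "E \<subseteq> I \<times> I" "r \<in> I" "(r, v) \<notin> E"
    "(u, v) \<in> E \<Longrightarrow> (u, w) \<in> E \<Longrightarrow> v = w" "v \<in> I \<Longrightarrow> (v, r) \<in> E\<^sup>*"
  using assms unfolding rtree_def by blast+

lemma rooted_trees_iff:
  "T \<in> rooted_trees I \<longleftrightarrow> pverts T = I \<and> rtree I (tree_root T) (parcs T)"
proof
  assume "T \<in> rooted_trees I"
  then have T: "rooted_tree T" and V: "pverts T = I" by (auto simp: rooted_trees_def)
  interpret pair_fin_digraph T using T by (rule rooted_treeD)
  have "finite I" "parcs T \<subseteq> I \<times> I"
    using pair_finite_verts in_arcsD1 in_arcsD2 V by auto
  with V rooted_treeD(3)[OF T, unfolded is_root_iff[OF pair_wf_digraph_axioms]]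
  show "pverts T = I \<and> rtree I (tree_root T) (parcs T)"
    unfolding rtree_def by blast
next
  assume R: "pverts T = I \<and> rtree I (tree_root T) (parcs T)"
  then have fin: "finite I" and sub: "parcs T \<subseteq> I \<times> I" by (auto simp: rtree_def)
  interpret pair_fin_digraph T
    using fin sub R finite_subset[OF sub] by unfold_locales auto
  have "is_root T (tree_root T)"
    unfolding is_root_iff[OF pair_wf_digraph_axioms] using R by (auto simp: rtree_def)
  then show "T \<in> rooted_trees I"
    using R pair_fin_digraph_axioms by (auto simp: rooted_trees_def rooted_tree_def)
qed

lemma rtree_imp_rooted:
  assumes R: "rtree I r E"
  shows "digraph_of I E \<in> rooted_trees I" "tree_root (digraph_of I E) = r"
proof -
  let ?T = "digraph_of I E"
  have fin: "finite I" and sub: "E \<subseteq> I \<times> I" using R by (auto simp: rtree_def)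
  interpret pair_fin_digraph ?T
    using fin sub finite_subset[OF sub] by unfold_locales auto
  have "is_root ?T r"
    unfolding is_root_iff[OF pair_wf_digraph_axioms] using R by (auto simp: rtree_def)
  then show "tree_root ?T = r"
    by (rule root_eqI[OF pair_wf_digraph_axioms])
  then show "?T \<in> rooted_trees I"
    using R by (simp add: rooted_trees_iff)
qed

text \<open>When no arc leaves \<open>r\<close>, the walk from \<open>r\<close> to the root of the
  tree has to be empty.\<close>

lemma tree_root_eqI:
  assumes "T \<in> rooted_trees I" "r \<in> I" "\<And>v. (r, v) \<notin> parcs T"
  shows "tree_root T = r"
proof -
  have "(r, tree_root T) \<in> (parcs T)\<^sup>*"
    using assms(1,2) by (auto simp: rooted_trees_iff rtree_def)
  then show ?thesis using assms(3) by (cases rule: converse_rtranclE) auto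
qed

text \<open>Arcs being single-valued, the walk to the root from a vertex on a closed walk never gets
  off the closed walk; but no arc leaves the root.\<close>

lemma rtree_acyclic:
  assumes R: "rtree I r E"
  shows "acyclic E"
  unfolding acyclic_def
proof (intro allI notI)
  fix u assume u: "(u, u) \<in> E\<^sup>+"
  then obtain v where "(u, v) \<in> E" by (meson tranclD)
  then have "u \<in> I" using rtreeD(2)[OF R] by blast
  then have "(u, r) \<in> E\<^sup>*" by (rule rtreeD(6)[OF R])
  then show False using u
  proof (induction rule: converse_rtrancl_induct)
    case base
    then show False using rtreeD(4)[OF R] by (meson tranclD)
  next
    case (step y z)
    from tranclD[OF step.prems] obtain z' where z': "(y, z') \<in> E" "(z', y) \<in> E\<^sup>*" by blast
    then have "z' = z" using rtreeD(5)[OF R] step.hyps(1) by blast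
    then have "(z, z) \<in> E\<^sup>+" using z' step.hyps(1) by (metis rtrancl_into_trancl1)
    then show False by (rule step.IH)
  qed
qed

section \<open>Exchanging arcs of a rooted tree\<close>

text \<open>The arc from \<open>r\<close> to \<open>v\<close> closes a cycle that runs from
  \<open>v\<close> through \<open>s\<close> and \<open>t\<close> back to \<open>r\<close>. Cutting
  the cycle behind \<open>s\<close> leaves a tree with root \<open>s\<close>.\<close>

lemma rtree_exchange:
  assumes R: "rtree I r E" and v: "v \<in> I" and e: "(s, t) \<in> E" and vs: "(v, s) \<in> E\<^sup>*"
  shows "rtree I s (insert (r, v) E - {(s, t)})"
proof (rule rtreeI)
  let ?G = "insert (r, v) E - {(s, t)}"
  note D = rtreeD[OF R]
  have sr: "s \<noteq> r" using D(4) e by blast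
  show "finite I" "?G \<subseteq> I \<times> I" "s \<in> I" using D(1,2,3) e v by auto
  show "(s, w) \<notin> ?G" for w using D(5)[OF e] sr by auto
  show "w = w'" if "(u, w) \<in> ?G" "(u, w') \<in> ?G" for u w w'
    using that D(4) D(5)[of u w w'] by auto
  \<comment> \<open>A walk to \<open>s\<close> may stop at its first visit to \<open>s\<close>, so
    it can avoid the deleted arc.\<close>
  have v's: "(w, s) \<in> ?G\<^sup>*" if "(w, s) \<in> E\<^sup>*" for w using that
  proof (induction rule: converse_rtrancl_induct)
    case (step y z)
    show ?case
    proof (cases "y = s")
      case False
      then have "(y, z) \<in> ?G" using step.hyps by auto
      then show ?thesis using step.IH by (rule converse_rtrancl_into_rtrancl)
    qed simp
  qed simp
  show "(u, s) \<in> ?G\<^sup>*" if "u \<in> I" for u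
    using D(6)[OF that]
  proof (induction rule: converse_rtrancl_induct)
    case base
    have "(r, v) \<in> ?G" using sr by auto
    then show ?case using v's[OF vs] by (rule converse_rtrancl_into_rtrancl)
  next
    case (step y z)
    show ?case
    proof (cases "y = s")
      case False
      then have "(y, z) \<in> ?G" using step.hyps by auto
      then show ?thesis using step.IH by (rule converse_rtrancl_into_rtrancl)
    qed simp
  qed
qed

lemma rtree_flip:
  assumes R: "rtree I r E" and e: "(q, r) \<in> E"
  shows "rtree I q (insert (r, q) (E - {(q, r)}))"
proof -
  have "q \<noteq> r" "q \<in> I" using rtreeD(2,4)[OF R] e by blast+
  then show ?thesis using rtree_exchange[OF R _ e] by (simp add: insert_Diff_if)
qed

text \<open>A walk through the removed arc takes the detour from \<open>b\<close> over its sibling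
  \<open>a\<close> to \<open>x\<close>.\<close>

lemma rtree_move:
  assumes R: "rtree I r E" and a: "(a, x) \<in> E" and b: "(b, x) \<in> E" and ab: "a \<noteq> b"
  shows "rtree I r (insert (b, a) (E - {(b, x)}))"
proof (rule rtreeI)
  let ?G = "insert (b, a) (E - {(b, x)})"
  note D = rtreeD[OF R]
  show "finite I" "?G \<subseteq> I \<times> I" "r \<in> I" using D(1,2,3) a b by auto
  show "(r, w) \<notin> ?G" for w using D(4) b by blast
  show "w = w'" if "(u, w) \<in> ?G" "(u, w') \<in> ?G" for u w w'
    using that D(5)[OF b] D(5)[of u w w'] by auto
  show "(u, r) \<in> ?G\<^sup>*" if "u \<in> I" for u
    using D(6)[OF that]
  proof (induction rule: converse_rtrancl_induct)
    case (step y z)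
    have "(y, z) \<in> ?G\<^sup>*"
    proof (cases "(y, z) = (b, x)")
      case True
      have "(b, a) \<in> ?G" "(a, x) \<in> ?G" using a ab by auto
      then show ?thesis using True by (auto intro: rtrancl_into_rtrancl)
    qed (use step.hyps in blast)
    then show ?case using step.IH by (rule rtrancl_trans)
  qed simp
qed

section \<open>Relations between the coefficients of an element of the kernel\<close>

text \<open>A tree contributes to the graph \<open>G\<close> exactly if it arises from
  \<open>G\<close> by deleting an arc that starts at its root. The condition that the arc is not a
  loop reflects that the divergence is the reduced one.\<close>

lemma lookup_div0:
  fixes x :: "('a, 'k::field) graph_vec"
  assumes I: "finite I" and x: "x \<in> RT I" and G: "G \<subseteq> I \<times> I"
  shows "Poly_Mapping.lookup (div0 x) (digraph_of I G) =
    (\<Sum>e | e \<in> G \<and> fst e \<noteq> snd e \<and> rtree I (fst e) (G - {e}).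
       Poly_Mapping.lookup x (digraph_of I (G - {e})))"
proof -
  let ?K = "Poly_Mapping.keys x" and ?c = "Poly_Mapping.lookup x"
  let ?G = "digraph_of I G"
  define S where "S = {e. e \<in> G \<and> fst e \<noteq> snd e \<and> rtree I (fst e) (G - {e})}"
  \<comment> \<open>The pairs of a tree in the support of \<open>x\<close> and a target for the new
    arc which together produce \<open>G\<close>.\<close>
  define Q where "Q = (SIGMA T:?K. {v \<in> pverts T - {tree_root T}. add_root_arc T v = ?G})"
  have K: "T \<in> rooted_trees I" if "T \<in> ?K" for T
    using x that by (auto simp: RT_def free_space_def)
  have finS: "finite S"
    using finite_subset[OF G] I by (auto simp: S_def)
  have "Poly_Mapping.lookup (div0 x) ?G =
      (\<Sum>T\<in>?K. \<Sum>v\<in>pverts T - {tree_root T}. if add_root_arc T v = ?G then ?c T else 0)"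
    unfolding div0_def lookup_lin_ext div0_tree_def
    by (simp add: lookup_sum lookup_single when_def sum_distrib_left if_distrib cong: if_cong)
  also have "\<dots> = (\<Sum>T\<in>?K. \<Sum>v | v \<in> pverts T - {tree_root T} \<and> add_root_arc T v = ?G. ?c T)"
  proof (rule sum.cong)
    fix T assume "T \<in> ?K"
    then have "finite (pverts T - {tree_root T})"
      using K I by (auto simp: rooted_trees_iff)
    then show "(\<Sum>v\<in>pverts T - {tree_root T}. if add_root_arc T v = ?G then ?c T else 0) =
        (\<Sum>v | v \<in> pverts T - {tree_root T} \<and> add_root_arc T v = ?G. ?c T)"
      by (intro sum.inter_filter[symmetric])
  qed simp
  also have "\<dots> = (\<Sum>(T, v)\<in>Q. ?c T)"
    unfolding Q_def
    by (rule sum.Sigma) (use K I in \<open>auto simp: rooted_trees_iff\<close>)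
  also have "\<dots> = (\<Sum>e\<in>{e\<in>S. digraph_of I (G - {e}) \<in> ?K}. ?c (digraph_of I (G - {e})))"
  \<comment> \<open>A pair in \<open>Q\<close> corresponds to the arc that it adds; the tree is
    recovered by deleting this arc.\<close>
  proof (rule sum.reindex_bij_witness[where
        j = "\<lambda>(T, v). (tree_root T, v)" and i = "\<lambda>e. (digraph_of I (G - {e}), snd e)"])
    fix p assume "p \<in> Q"
    then obtain T v where p: "p = (T, v)" and T: "T \<in> ?K" and v: "v \<in> pverts T" "v \<noteq> tree_root T"
      and TG: "add_root_arc T v = ?G" by (auto simp: Q_def)
    from K[OF T] have V: "pverts T = I" and R: "rtree I (tree_root T) (parcs T)"
      by (auto simp: rooted_trees_iff)
    have GE: "G = insert (tree_root T, v) (parcs T)" using TG by (simp add: add_root_arc_def)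
    have "(tree_root T, v) \<notin> parcs T" using rtreeD(4)[OF R] .
    then have D: "G - {(tree_root T, v)} = parcs T" using GE by blast
    then have TD: "digraph_of I (G - {(tree_root T, v)}) = T" using V by simp
    show "(digraph_of I (G - {case p of (T, v) \<Rightarrow> (tree_root T, v)}),
        snd (case p of (T, v) \<Rightarrow> (tree_root T, v))) = p"
      using TD p by simp
    show "(case p of (T, v) \<Rightarrow> (tree_root T, v)) \<in> {e\<in>S. digraph_of I (G - {e}) \<in> ?K}"
      using TD p T R v D GE by (auto simp: S_def)
    show "?c (digraph_of I (G - {case p of (T, v) \<Rightarrow> (tree_root T, v)})) =
        (case p of (T, v) \<Rightarrow> ?c T)"
      using TD p by simp
  next
    fix e assume e: "e \<in> {e\<in>S. digraph_of I (G - {e}) \<in> ?K}"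
    then have R: "rtree I (fst e) (G - {e})" and eG: "e \<in> G" "fst e \<noteq> snd e" by (auto simp: S_def)
    have r: "tree_root (digraph_of I (G - {e})) = fst e" by (rule rtree_imp_rooted[OF R])
    show "(case (digraph_of I (G - {e}), snd e) of (T, v) \<Rightarrow> (tree_root T, v)) = e"
      using r by simp
    show "(digraph_of I (G - {e}), snd e) \<in> Q"
      using e eG r G by (auto simp: Q_def add_root_arc_def insert_absorb)
  qed
  also have "\<dots> = (\<Sum>e\<in>S. ?c (digraph_of I (G - {e})))"
    by (rule sum.mono_neutral_left) (use finS in \<open>auto simp: in_keys_iff\<close>)
  finally show ?thesis by (simp add: S_def)
qed

text \<open>Adding the arc from \<open>r\<close> to \<open>q\<close> creates a two-cycle. Only
  deleting one of its two arcs gives a tree, so the coefficient of \<open>div0 x\<close> there is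
  the sum of the two coefficients compared here.\<close>

lemma div0_zero_flip:
  fixes x :: "('a, 'k::field) graph_vec"
  assumes x: "x \<in> RT I" "div0 x = 0" and R: "rtree I r E" and e: "(q, r) \<in> E"
  shows "Poly_Mapping.lookup x (digraph_of I E) =
    - Poly_Mapping.lookup x (digraph_of I (insert (r, q) (E - {(q, r)})))"
proof -
  let ?G = "insert (r, q) E" and ?E' = "insert (r, q) (E - {(q, r)})"
  have qr: "q \<noteq> r" "(r, q) \<notin> E" using rtreeD(4)[OF R] e by blast+
  have G: "?G \<subseteq> I \<times> I" using rtreeD(2)[OF R] e by blast
  have d: "?G - {(r, q)} = E" "?G - {(q, r)} = ?E'" using qr by auto
  have "{e. e \<in> ?G \<and> fst e \<noteq> snd e \<and> rtree I (fst e) (?G - {e})} = {(r, q), (q, r)}" (is "?S = _")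
  proof
    show "?S \<subseteq> {(r, q), (q, r)}"
    proof (rule ccontr)
      assume "\<not> ?S \<subseteq> {(r, q), (q, r)}"
      then obtain e' where e': "e' \<noteq> (r, q)" "e' \<noteq> (q, r)" "rtree I (fst e') (?G - {e'})" by blast
      \<comment> \<open>Any other deletion leaves the two-cycle intact, against acyclicity.\<close>
      then have "(r, q) \<in> ?G - {e'}" "(q, r) \<in> ?G - {e'}" using e by auto
      then have "(r, r) \<in> (?G - {e'})\<^sup>+" by (meson trancl.intros)
      then show False using rtree_acyclic[OF e'(3)] by (auto simp: acyclic_def)
    qed
    show "{(r, q), (q, r)} \<subseteq> ?S"
      using R rtree_flip[OF R e] e qr d by auto
  qed
  then have "0 = (\<Sum>e\<in>{(r, q), (q, r)}. Poly_Mapping.lookup x (digraph_of I (?G - {e})))"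
    using lookup_div0[OF rtreeD(1)[OF R] x(1) G] x(2) by simp
  also have "\<dots> = Poly_Mapping.lookup x (digraph_of I (?G - {(r, q)})) +
      Poly_Mapping.lookup x (digraph_of I (?G - {(q, r)}))"
    using qr by simp
  also have "\<dots> = Poly_Mapping.lookup x (digraph_of I E) + Poly_Mapping.lookup x (digraph_of I ?E')"
    by (simp only: d)
  finally show ?thesis by (simp add: eq_neg_iff_add_eq_0)
qed

text \<open>The graph \<open>?G\<close> has the three-cycle \<open>r -> q -> p -> r\<close>.
  Deleting its arcs in turn gives the tree with \<open>q\<close> moved to \<open>p\<close>, the
  given tree with its root moved to \<open>q\<close>, and the tree with \<open>p\<close> moved to
  \<open>q\<close> and its root moved to \<open>p\<close>. The sign rule brings all roots back to
  \<open>r\<close>.\<close>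

lemma div0_zero_branch:
  fixes x :: "('a, 'k::field) graph_vec"
  assumes x: "x \<in> RT I" "div0 x = 0" and R: "rtree I r E"
    and p: "(p, r) \<in> E" and q: "(q, r) \<in> E" and pq: "p \<noteq> q"
  shows "Poly_Mapping.lookup x (digraph_of I E) =
    Poly_Mapping.lookup x (digraph_of I (insert (q, p) (E - {(q, r)}))) +
    Poly_Mapping.lookup x (digraph_of I (insert (p, q) (E - {(p, r)})))"
proof -
  let ?c = "\<lambda>E. Poly_Mapping.lookup x (digraph_of I E)"
  let ?E1 = "insert (q, p) (E - {(q, r)})" and ?E2 = "insert (p, q) (E - {(p, r)})"
  let ?G = "insert (r, q) ?E1"
  have R1: "rtree I r ?E1" by (rule rtree_move[OF R p q pq])
  have R2: "rtree I r ?E2" by (rule rtree_move[OF R q p pq[symmetric]])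
  note D = rtreeD[OF R]
  have ne: "p \<noteq> r" "q \<noteq> r" "(r, q) \<notin> E" using D(4) p q by blast+
  have npq: "(p, q) \<notin> E" "(q, p) \<notin> E" using D(5) p q ne by blast+
  have mem: "p \<in> I" "q \<in> I" "r \<in> I" using D(2) p q by blast+
  have G: "?G \<subseteq> I \<times> I" using D(2) mem by blast
  let ?Ea = "insert (r, q) (E - {(q, r)})"
  let ?Eb = "insert (r, q) (?E2 - {(q, r)})"
  let ?Ec = "insert (q, p) (?Eb - {(p, q)})"
  have d: "?G - {(r, q)} = ?E1" "?G - {(q, p)} = ?Ea" "?G - {(p, r)} = ?Ec"
    using ne npq pq p q by auto
  have qE2: "(q, r) \<in> ?E2" using q pq by auto
  have Ra: "rtree I q ?Ea" by (rule rtree_flip[OF R q])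
  have Rb: "rtree I q ?Eb" by (rule rtree_flip[OF R2 qE2])
  have pEb: "(p, q) \<in> ?Eb" using ne by auto
  have Rc: "rtree I p ?Ec" by (rule rtree_flip[OF Rb pEb])
  have "{e. e \<in> ?G \<and> fst e \<noteq> snd e \<and> rtree I (fst e) (?G - {e})} = {(r, q), (q, p), (p, r)}"
    (is "?S = ?C")
  proof
    show "?S \<subseteq> ?C"
    proof (rule ccontr)
      assume "\<not> ?S \<subseteq> ?C"
      then obtain e where e: "e \<notin> ?C" "rtree I (fst e) (?G - {e})" by blast
      then have "(r, q) \<in> ?G - {e}" "(q, p) \<in> ?G - {e}" "(p, r) \<in> ?G - {e}" using p pq by auto
      then have "(r, r) \<in> (?G - {e})\<^sup>+" by (meson trancl.intros)
      then show False using rtree_acyclic[OF e(2)] by (auto simp: acyclic_def)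
    qed
    have "e \<in> ?S" if "e \<in> ?C" for e
      using that
    proof (elim insertE emptyE)
      assume "e = (r, q)" then show ?thesis using d(1) R1 ne by auto
    next
      assume "e = (q, p)" then show ?thesis using d(2) Ra pq by auto
    next
      assume "e = (p, r)" then show ?thesis using d(3) Rc ne p pq by auto
    qed
    then show "?C \<subseteq> ?S" by blast
  qed
  then have "0 = (\<Sum>e\<in>?C. ?c (?G - {e}))"
    using lookup_div0[OF D(1) x(1) G] x(2) by simp
  also have "\<dots> = ?c (?G - {(r, q)}) + (?c (?G - {(q, p)}) + ?c (?G - {(p, r)}))"
    using ne pq by simp
  also have "\<dots> = ?c ?E1 + (?c ?Ea + ?c ?Ec)" by (simp only: d)
  also have "?c ?Ea = - ?c E" using div0_zero_flip[OF x R q] by simp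
  \<comment> \<open>The root moves from \<open>r\<close> to \<open>q\<close> and then to
    \<open>p\<close>, and the two signs cancel.\<close>
  also have "?c ?Ec = ?c ?E2"
    using div0_zero_flip[OF x R2 qE2] div0_zero_flip[OF x Rb pEb] by simp
  finally show ?thesis by (simp add: algebra_simps)
qed

section \<open>Chains, and vanishing of coefficients from vanishing on chains\<close>

text \<open>The list starts at the root and ends at the leaf: arcs lead from each entry to the one
  before it.\<close>

fun chain :: "'a list \<Rightarrow> ('a \<times> 'a) set" where
  "chain (b # c # rs) = insert (c, b) (chain (c # rs))"
| "chain rs = {}"

lemma chain_dom: "fst ` chain rs = set (tl rs)"
  by (induction rs rule: chain.induct) auto

lemma chain_ran: "snd ` chain rs = set (butlast rs)"
  by (induction rs rule: chain.induct) auto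

lemma chain_arcD:
  assumes "(u, v) \<in> chain rs"
  shows "u \<in> set (tl rs)" "v \<in> set (butlast rs)"
  using assms chain_dom[of rs] chain_ran[of rs] by (metis fst_conv imageI, metis snd_conv imageI)

lemma chain_arcE:
  assumes "u \<in> set (tl rs)" obtains v where "(u, v) \<in> chain rs"
  using assms chain_dom[of rs] by (metis fst_conv imageE prod.collapse)

lemma rtree_chain:
  assumes "distinct rs" "rs \<noteq> []"
  shows "rtree (set rs) (hd rs) (chain rs)"
  using assms
proof (induction rs rule: chain.induct)
  case (1 b c rs)
  then have R: "rtree (set (c # rs)) c (chain (c # rs))" and b: "b \<notin> set (c # rs)" by auto
  note D = rtreeD[OF R]
  have nb: "(u, b) \<notin> chain (c # rs)" "(b, u) \<notin> chain (c # rs)" for u using D(2) b by auto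
  have "rtree (set (b # c # rs)) b (insert (c, b) (chain (c # rs)))"
  proof (rule rtreeI)
    show "(v, b) \<in> (insert (c, b) (chain (c # rs)))\<^sup>*" if "v \<in> set (b # c # rs)" for v
    proof (cases "v = b")
      case False
      then have "(v, c) \<in> (chain (c # rs))\<^sup>*" using D(6) that by auto
      then have "(v, c) \<in> (insert (c, b) (chain (c # rs)))\<^sup>*"
        by (rule rtrancl_mono[THEN subsetD, rotated]) auto
      then show ?thesis by (rule rtrancl_into_rtrancl) simp
    qed simp
    show "v = w" if "(u, v) \<in> insert (c, b) (chain (c # rs))"
      "(u, w) \<in> insert (c, b) (chain (c # rs))" for u v w
      using that D(4) D(5) by blast
  qed (use D(2) nb b in auto)
  then show ?case by simp
qed (auto simp: rtree_def)

text \<open>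
  The tree is a chain from \<open>a\<close> to the root with all further branches hanging off the root.  If there
  is exactly one such branch, the root moves into it, making the chain longer; if there
  are several, the three-cycle relation reduces their number.
\<close>

lemma div0_zero_broom:
  fixes x :: "('a, 'k::field) graph_vec"
  assumes x: "x \<in> RT I" "div0 x = 0"
    and van: "\<And>rs. distinct rs \<Longrightarrow> rs \<noteq> [] \<Longrightarrow> set rs = I \<Longrightarrow> last rs = a \<Longrightarrow>
      Poly_Mapping.lookup x (digraph_of I (chain rs)) = 0"
    and R: "rtree I r E" and dist: "distinct (r # rs)" and last: "last (r # rs) = a"
    and sub: "chain (r # rs) \<subseteq> E"
    and bare: "\<And>u v. (u, v) \<in> E \<Longrightarrow> v \<in> set rs \<Longrightarrow> (u, v) \<in> chain (r # rs)"
  shows "Poly_Mapping.lookup x (digraph_of I E) = 0"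
  using R dist last sub bare
\<comment> \<open>The outer induction lengthens the chain; the inner one reduces the number of
  branches at the root off the chain.\<close>
proof (induction "card I - length rs" arbitrary: E r rs rule: less_induct)
  case (less rs E r)
  note outer = less.hyps
  show ?case
    using less.prems
  proof (induction "card {u. (u, r) \<in> E \<and> u \<notin> set rs}" arbitrary: E rule: less_induct)
    case (less E)
    note R = less.prems(1) and dist = less.prems(2) and last = less.prems(3)
      and sub = less.prems(4) and bare = less.prems(5)
    note D = rtreeD[OF R]
    let ?K = "\<lambda>E. {u. (u, r) \<in> E \<and> u \<notin> set rs}"
    have rI: "set rs \<subseteq> I"
      using sub D(2) chain_dom[of "r # rs"] by force
    consider "?K E = {}" | q where "?K E = {q}" | p q where "p \<in> ?K E" "q \<in> ?K E" "p \<noteq> q" by blast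
    then show ?case
    proof cases
      \<comment> \<open>By \<open>bare\<close> there is now no branch anywhere off the chain, so the
        tree is the chain itself.\<close>
      case 1
      have "v \<in> set (r # rs)" if "v \<in> I" for v
        using D(6)[OF that]
      proof (induction rule: converse_rtrancl_induct)
        case (step y z)
        show ?case
        proof (cases "z = r")
          case True
          then show ?thesis using step.hyps 1 by auto
        next
          case False
          then have "(y, z) \<in> chain (r # rs)" using step bare by auto
          then show ?thesis using chain_arcD(1) by fastforce
        qed
      qed simp
      then have I: "set (r # rs) = I" using rI D(3) by auto
      have "E \<subseteq> chain (r # rs)"
      proof
        fix e assume e: "e \<in> E"
        obtain u v where uv: "e = (u, v)" by (cases e)
        then have "u \<in> I" "u \<noteq> r" using D(2,4) e by auto
        then have "u \<in> set (tl (r # rs))" using I by auto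
        then obtain w where "(u, w) \<in> chain (r # rs)" by (rule chain_arcE)
        then show "e \<in> chain (r # rs)" using D(5) sub e uv by blast
      qed
      then have "E = chain (r # rs)" using sub by blast
      then show ?thesis using van[of "r # rs"] dist last I by simp
    next
      \<comment> \<open>After the root has moved to the only branch \<open>q\<close>, no further
        branch is left at \<open>r\<close>, and \<open>r\<close> joins the bare part of the
        chain.\<close>
      case (2 q)
      then have q: "(q, r) \<in> E" "q \<notin> set rs" by auto
      have qr: "q \<noteq> r" "q \<in> I" using D(2,4) q(1) by auto
      let ?E' = "insert (r, q) (E - {(q, r)})"
      have nin: "(q, r) \<notin> chain (r # rs)" using chain_arcD(1)[of q r "r # rs"] q(2) by auto
      have "set (q # r # rs) \<subseteq> I" using qr rI D(3) by auto
      then have "card (set (q # r # rs)) \<le> card I" by (rule card_mono[OF D(1)])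
      \<comment> \<open>Subtraction is truncated: the measure drops because \<open>q\<close>,
        \<open>r\<close> and the entries of \<open>rs\<close> are distinct vertices of
        \<open>I\<close>.\<close>
      then have "Suc (Suc (length rs)) \<le> card I"
        using dist q qr by (simp add: distinct_card)
      then have "card I - length (r # rs) < card I - length rs" by simp
      then have "Poly_Mapping.lookup x (digraph_of I ?E') = 0"
      proof (rule outer)
        show "rtree I q ?E'" by (rule rtree_flip[OF R q(1)])
        show "distinct (q # r # rs)" "last (q # r # rs) = a" using dist last q qr by auto
        show "chain (q # r # rs) \<subseteq> ?E'" using sub nin by auto
        fix u v assume uv: "(u, v) \<in> ?E'" "v \<in> set (r # rs)"
        then have uvE: "(u, v) \<in> E" "(u, v) \<noteq> (q, r)" using q(2) qr by auto
        have "(u, v) \<in> chain (r # rs)"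
        proof (cases "v = r")
          case True
          then have "u \<in> set (tl (r # rs))" using uvE 2 by auto
          then obtain w where "(u, w) \<in> chain (r # rs)" by (rule chain_arcE)
          then show ?thesis using D(5) uvE(1) sub by blast
        next
          case False
          then show ?thesis using bare uvE(1) uv(2) by auto
        qed
        then show "(u, v) \<in> chain (q # r # rs)" by simp
      qed
      then show ?thesis using div0_zero_flip[OF x R q(1)] by simp
    next
      case (3 p q)
      have finE: "finite (?K E)"
        using finite_subset[of "?K E" I] D(1,2) by blast
      \<comment> \<open>Moving \<open>q\<close> to \<open>p\<close> takes \<open>q\<close> away from
        the root and keeps \<open>bare\<close>, as \<open>p\<close> is off the chain. Being general
        in \<open>p\<close> and \<open>q\<close>, this covers both summands of the three-cycle
        relation.\<close>
      have half: "Poly_Mapping.lookup x (digraph_of I (insert (q, p) (E - {(q, r)}))) = 0"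
        if p: "(p, r) \<in> E" "p \<notin> set rs" and q: "(q, r) \<in> E" "q \<notin> set rs" and pq: "p \<noteq> q" for p q
      proof (rule less.hyps)
        let ?E' = "insert (q, p) (E - {(q, r)})"
        have pr: "p \<noteq> r" using D(4) p by blast
        then have "?K ?E' = ?K E - {q}" by auto
        then show "card (?K ?E') < card (?K E)"
          using q finE by (metis (no_types, lifting) card_Diff1_less mem_Collect_eq)
        show "rtree I r ?E'" by (rule rtree_move[OF R p(1) q(1) pq])
        show "distinct (r # rs)" "last (r # rs) = a" by (fact dist, fact last)
        have "(q, r) \<notin> chain (r # rs)" using chain_arcD(1)[of q r "r # rs"] q(2) by auto
        then show "chain (r # rs) \<subseteq> ?E'" using sub by auto
        show "(u, v) \<in> chain (r # rs)" if "(u, v) \<in> ?E'" "v \<in> set rs" for u v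
          using that bare p(2) by auto
      qed
      show ?thesis
        using div0_zero_branch[OF x R, of p q] half[of p q] half[of q p] 3 by simp
    qed
  qed
qed

text \<open>If \<open>a\<close> is the root, the previous lemma applies with the chain consisting of
  \<open>a\<close> alone. Otherwise the sign rule moves the root one arc towards \<open>a\<close>,
  and induction on the distance applies.\<close>

lemma div0_zero_eq_0I:
  fixes x :: "('a, 'k::field) graph_vec"
  assumes x: "x \<in> RT I" "div0 x = 0" and a: "a \<in> I"
    and van: "\<And>rs. distinct rs \<Longrightarrow> rs \<noteq> [] \<Longrightarrow> set rs = I \<Longrightarrow> last rs = a \<Longrightarrow>
      Poly_Mapping.lookup x (digraph_of I (chain rs)) = 0"
  shows "x = 0"
proof -
  have main: "Poly_Mapping.lookup x (digraph_of I E) = 0"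
    if "rtree I r E" "(a, r) \<in> E ^^ n" for n r E
    using that
  proof (induction n arbitrary: r E)
    case 0
    show ?case
      by (rule div0_zero_broom[OF x van, where r = r and rs = "[]"]) (use 0 in auto)
  next
    case (Suc n)
    note D = rtreeD[OF Suc.prems(1)]
    from Suc.prems(2) obtain q where q: "(a, q) \<in> E ^^ n" "(q, r) \<in> E" by auto
    let ?E' = "insert (r, q) (E - {(q, r)})"
    have qr: "q \<noteq> r" using D(4) q(2) by blast
    \<comment> \<open>Walks to \<open>q\<close> survive the flip: they cannot pass through
      \<open>r\<close>, where no arc starts, so they avoid the arc from \<open>q\<close> to
      \<open>r\<close>.\<close>
    have "(w, q) \<in> ?E' ^^ m" if "(w, q) \<in> E ^^ m" for w m
      using that
    proof (induction m arbitrary: w)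
      case (Suc m)
      from relpow_Suc_D2[OF Suc.prems] obtain z where z: "(w, z) \<in> E" "(z, q) \<in> E ^^ m" by blast
      have "(z, q) \<in> E\<^sup>*" using z(2) by (rule relpow_imp_rtrancl)
      then have "z \<noteq> r" using qr D(4) by (metis converse_rtranclE)
      then have "(w, z) \<in> ?E'" using z(1) by auto
      then show ?case using Suc.IH[OF z(2)] by (rule relpow_Suc_I2)
    qed simp
    then have "Poly_Mapping.lookup x (digraph_of I ?E') = 0"
      using Suc.IH rtree_flip[OF Suc.prems(1) q(2)] q(1) by blast
    then show ?case using div0_zero_flip[OF x Suc.prems(1) q(2)] by simp
  qed
  show ?thesis
  proof (rule poly_mapping_eqI)
    fix T
    show "Poly_Mapping.lookup x T = Poly_Mapping.lookup 0 T"
    proof (cases "T \<in> rooted_trees I")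
      case True
      then have V: "pverts T = I" and R: "rtree I (tree_root T) (parcs T)"
        by (auto simp: rooted_trees_iff)
      obtain n where "(a, tree_root T) \<in> parcs T ^^ n"
        using rtreeD(6)[OF R a] rtrancl_imp_relpow by blast
      then have "Poly_Mapping.lookup x (digraph_of I (parcs T)) = 0" by (rule main[OF R])
      moreover have "digraph_of I (parcs T) = T" using V by simp
      ultimately show ?thesis by simp
    next
      case False
      then show ?thesis using x(1) by (auto simp: RT_def free_space_def in_keys_iff)
    qed
  qed
qed

section \<open>The kernel is a suboperad\<close>

lemma tree_root_relabel_graph:
  assumes T: "T \<in> rooted_trees I" and \<sigma>: "bij_betw \<sigma> I J"
  shows "tree_root (relabel_graph \<sigma> T) = \<sigma> (tree_root T)"
proof (rule tree_root_eqI[OF relabel_rooted[OF T \<sigma>]])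
  from T have R: "rtree I (tree_root T) (parcs T)" by (simp add: rooted_trees_iff)
  note D = rtreeD[OF R]
  show "\<sigma> (tree_root T) \<in> J" using D(3) \<sigma> by (auto simp: bij_betw_def)
  show "(\<sigma> (tree_root T), v) \<notin> parcs (relabel_graph \<sigma> T)" for v
  proof
    assume "(\<sigma> (tree_root T), v) \<in> parcs (relabel_graph \<sigma> T)"
    then obtain u w where uw: "(u, w) \<in> parcs T" "\<sigma> u = \<sigma> (tree_root T)"
      by (auto simp: relabel_graph_def)
    then have "u = tree_root T"
      using D(2,3) \<sigma> by (auto simp: bij_betw_def dest: inj_onD)
    then show False using D(4) uw(1) by blast
  qed
qed

lemma relabel_div0_tree:
  assumes T: "T \<in> rooted_trees I" and \<sigma>: "bij_betw \<sigma> I J"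
  shows "div0_tree (relabel_graph \<sigma> T) = relabel \<sigma> (div0_tree T)"
proof -
  from T have V: "pverts T = I" and r: "tree_root T \<in> I" by (auto simp: rooted_trees_iff rtree_def)
  have inj: "inj_on \<sigma> I" using \<sigma> by (simp add: bij_betw_def)
  have "pverts (relabel_graph \<sigma> T) - {tree_root (relabel_graph \<sigma> T)} = \<sigma> ` (I - {tree_root T})"
    unfolding tree_root_relabel_graph[OF T \<sigma>] using V inj r
    by (auto simp: relabel_graph_def dest: inj_onD)
  then have "div0_tree (relabel_graph \<sigma> T) =
      (\<Sum>v\<in>I - {tree_root T}. basis_vec (add_root_arc (relabel_graph \<sigma> T) (\<sigma> v)))"
    unfolding div0_tree_def by (simp add: sum.reindex[OF inj_on_subset[OF inj]])
  also have "\<dots> = relabel \<sigma> (div0_tree T)"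
    unfolding div0_tree_def relabel_def lin_ext_sum V
    by (intro sum.cong refl)
      (simp add: add_root_arc_def tree_root_relabel_graph[OF T \<sigma>],
        simp add: relabel_graph_def)
  finally show ?thesis .
qed

lemma div0_relabel:
  assumes x: "x \<in> RT I" and \<sigma>: "bij_betw \<sigma> I J"
  shows "div0 (relabel \<sigma> x) = relabel \<sigma> (div0 x)"
  unfolding div0_def relabel_def lin_ext_lin_ext
  using x[unfolded RT_def]
  by (rule lin_ext_cong) (simp add: relabel_div0_tree[OF _ \<sigma>] relabel_def)

section \<open>The divergence of a composition\<close>

lemma tree_root_graft:
  assumes T1: "T1 \<in> rooted_trees A" and T2: "T2 \<in> rooted_trees J" and s: "s \<in> A"
    and disj: "(A - {s}) \<inter> J = {}" and f: "f \<in> {u. (u, s) \<in> parcs T1} \<rightarrow>\<^sub>E pverts T2"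
  shows "tree_root (graft s T1 T2 f) = (if tree_root T1 = s then tree_root T2 else tree_root T1)"
proof -
  have "rooted_tree T1" "rooted_tree T2" "s \<in> pverts T1" "(pverts T1 - {s}) \<inter> pverts T2 = {}"
    using T1 T2 s disj by (auto simp: rooted_trees_def)
  note G = is_root_graft[OF this f]
  from G(1) interpret pair_fin_digraph "graft s T1 T2 f" .
  show ?thesis by (rule root_eqI[OF pair_wf_digraph_axioms G(2)])
qed

text \<open>The new arc starts at the root of \<open>T2\<close>. If it ends in
  \<open>A - {s}\<close>, it comes from an arc of \<open>T1\<close> leaving \<open>s\<close>; if it
  ends in \<open>J\<close>, it already exists within \<open>T2\<close>, ending at a non-root
  vertex.\<close>

lemma div0_compose_trees_root:
  assumes T1: "T1 \<in> rooted_trees A" and T2: "T2 \<in> rooted_trees J"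
    and disj: "(A - {s}) \<inter> J = {}" and r: "tree_root T1 = s"
  shows "div0 (compose_trees s T1 T2 :: ('a, 'k::field) graph_vec) =
    lin_ext (\<lambda>G. compose_trees s G T2) (div0_tree T1) +
    lin_ext (compose_trees s T1) (div0_tree T2)"
proof -
  from T1 r have V1: "pverts T1 = A" and R1: "rtree A s (parcs T1)"
    by (auto simp: rooted_trees_iff)
  from T2 have V2: "pverts T2 = J" and R2: "rtree J (tree_root T2) (parcs T2)"
    by (auto simp: rooted_trees_iff)
  note D1 = rtreeD[OF R1] and D2 = rtreeD[OF R2]
  let ?F = "{u. (u, s) \<in> parcs T1} \<rightarrow>\<^sub>E J" and ?r = "tree_root T2"
  have r2: "?r \<notin> A - {s}" using disj D2(3) by blast
  have root: "tree_root (graft s T1 T2 f) = ?r" if "f \<in> ?F" for f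
    using tree_root_graft[OF T1 T2 D1(3) disj] that r V2 by simp
  have "div0 (compose_trees s T1 T2 :: ('a, 'k) graph_vec) =
      (\<Sum>f\<in>?F. \<Sum>v\<in>A - {s} \<union> (J - {?r}). basis_vec (add_root_arc (graft s T1 T2 f) v))"
    unfolding compose_trees_def div0_def lin_ext_sum V2
  proof (intro sum.cong refl)
    fix f assume f: "f \<in> ?F"
    have "pverts (graft s T1 T2 f) - {?r} = A - {s} \<union> (J - {?r})"
      using r2 V1 V2 by (auto simp: graft_def)
    then show "lin_ext div0_tree (basis_vec (graft s T1 T2 f) :: ('a, 'k) graph_vec) =
        (\<Sum>v\<in>A - {s} \<union> (J - {?r}). basis_vec (add_root_arc (graft s T1 T2 f) v))"
      by (simp add: div0_tree_def root[OF f])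
  qed
  also have "\<dots> = (\<Sum>f\<in>?F. (\<Sum>v\<in>A - {s}. basis_vec (add_root_arc (graft s T1 T2 f) v)) +
      (\<Sum>v\<in>J - {?r}. basis_vec (add_root_arc (graft s T1 T2 f) v)))"
    by (intro sum.cong refl sum.union_disjoint) (use D1(1) D2(1) disj in auto)
  also have "\<dots> = (\<Sum>v\<in>A - {s}. \<Sum>f\<in>?F. basis_vec (add_root_arc (graft s T1 T2 f) v)) +
      (\<Sum>v\<in>J - {?r}. \<Sum>f\<in>?F. basis_vec (add_root_arc (graft s T1 T2 f) v))"
    unfolding sum.distrib by (intro arg_cong2[of _ _ _ _ "(+)"] sum.swap)
  also have "(\<Sum>v\<in>A - {s}. \<Sum>f\<in>?F. basis_vec (add_root_arc (graft s T1 T2 f) v)) =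
      (lin_ext (\<lambda>G. compose_trees s G T2) (div0_tree T1) :: ('a, 'k) graph_vec)"
    unfolding div0_tree_def lin_ext_sum lin_ext_basis_vec compose_trees_def V1 V2 r
  proof (intro sum.cong refl)
    fix v assume v: "v \<in> A - {s}"
    then show "?F = {u. (u, s) \<in> parcs (add_root_arc T1 v)} \<rightarrow>\<^sub>E J"
      by (auto simp: add_root_arc_def)
    fix f assume "f \<in> {u. (u, s) \<in> parcs (add_root_arc T1 v)} \<rightarrow>\<^sub>E J"
    with v have f: "f \<in> ?F" by (auto simp: add_root_arc_def)
    have "add_root_arc (graft s T1 T2 f) v = graft s (add_root_arc T1 v) T2 f"
      unfolding add_root_arc_def root[OF f] unfolding graft_def using v r by auto
    then show "basis_vec (add_root_arc (graft s T1 T2 f) v) =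
        (basis_vec (graft s (add_root_arc T1 v) T2 f) :: ('a, 'k) graph_vec)" by simp
  qed
  also have "(\<Sum>v\<in>J - {?r}. \<Sum>f\<in>?F. basis_vec (add_root_arc (graft s T1 T2 f) v)) =
      (lin_ext (compose_trees s T1) (div0_tree T2) :: ('a, 'k) graph_vec)"
    unfolding div0_tree_def lin_ext_sum lin_ext_basis_vec compose_trees_def V2
  proof (intro sum.cong refl)
    fix v assume v: "v \<in> J - {?r}"
    show "?F = {u. (u, s) \<in> parcs T1} \<rightarrow>\<^sub>E pverts (add_root_arc T2 v)"
      using V2 by (simp add: add_root_arc_def)
    fix f assume "f \<in> {u. (u, s) \<in> parcs T1} \<rightarrow>\<^sub>E pverts (add_root_arc T2 v)"
    then have f: "f \<in> ?F" using V2 by (simp add: add_root_arc_def)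
    \<comment> \<open>After adding the arc, \<open>T2\<close> is no tree and its
      \<open>tree_root\<close> carries no meaning, but \<open>graft\<close> would use it only for
      arcs leaving \<open>s\<close>, and the root \<open>s\<close> has none.\<close>
    have "add_root_arc (graft s T1 T2 f) v = graft s T1 (add_root_arc T2 v) f"
      unfolding add_root_arc_def root[OF f] unfolding graft_def using D1(4) by auto
    then show "basis_vec (add_root_arc (graft s T1 T2 f) v) =
        (basis_vec (graft s T1 (add_root_arc T2 v) f) :: ('a, 'k) graph_vec)" by simp
  qed
  finally show ?thesis .
qed

text \<open>The new arc starts at the root of \<open>T1\<close>. Its possible ends in
  \<open>J\<close> include the root of \<open>T2\<close> and are exactly the ways to reconnect an
  arc from the root of \<open>T1\<close> to \<open>s\<close>; hence \<open>div0_tree T2\<close> does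
  not enter.\<close>

lemma div0_compose_trees_nonroot:
  assumes T1: "T1 \<in> rooted_trees A" and T2: "T2 \<in> rooted_trees J" and s: "s \<in> A"
    and disj: "(A - {s}) \<inter> J = {}" and rs: "tree_root T1 \<noteq> s"
  shows "div0 (compose_trees s T1 T2 :: ('a, 'k::field) graph_vec) =
    lin_ext (\<lambda>G. compose_trees s G T2) (div0_tree T1)"
proof -
  let ?r = "tree_root T1"
  from T1 have V1: "pverts T1 = A" and R1: "rtree A ?r (parcs T1)"
    by (auto simp: rooted_trees_iff)
  from T2 have V2: "pverts T2 = J" and R2: "rtree J (tree_root T2) (parcs T2)"
    by (auto simp: rooted_trees_iff)
  note D1 = rtreeD[OF R1] and D2 = rtreeD[OF R2]
  let ?D = "{u. (u, s) \<in> parcs T1}"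
  let ?F = "?D \<rightarrow>\<^sub>E J"
  have rJ: "?r \<notin> J" using disj D1(3) rs by blast
  have root: "tree_root (graft s T1 T2 f) = ?r" if "f \<in> ?F" for f
    using tree_root_graft[OF T1 T2 s disj] that rs V2 by simp
  let ?g = "\<lambda>f v. basis_vec (add_root_arc (graft s T1 T2 f) v) :: ('a, 'k) graph_vec"
  have "div0 (compose_trees s T1 T2 :: ('a, 'k) graph_vec) =
      (\<Sum>f\<in>?F. \<Sum>v\<in>(A - {?r} - {s}) \<union> J. ?g f v)"
    unfolding compose_trees_def div0_def lin_ext_sum V2
  proof (intro sum.cong refl)
    fix f assume f: "f \<in> ?F"
    have "pverts (graft s T1 T2 f) - {?r} = (A - {?r} - {s}) \<union> J"
      using rJ V1 V2 by (auto simp: graft_def)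
    then show "lin_ext div0_tree (basis_vec (graft s T1 T2 f) :: ('a, 'k) graph_vec) =
        (\<Sum>v\<in>(A - {?r} - {s}) \<union> J. ?g f v)"
      by (simp add: div0_tree_def root[OF f])
  qed
  also have "\<dots> = (\<Sum>f\<in>?F. (\<Sum>v\<in>A - {?r} - {s}. ?g f v) + (\<Sum>v\<in>J. ?g f v))"
    by (intro sum.cong refl sum.union_disjoint) (use D1(1) D2(1) disj in auto)
  also have "\<dots> = (\<Sum>v\<in>A - {?r} - {s}. \<Sum>f\<in>?F. ?g f v) + (\<Sum>v\<in>J. \<Sum>f\<in>?F. ?g f v)"
    unfolding sum.distrib by (intro arg_cong2[of _ _ _ _ "(+)"] sum.swap)
  also have "(\<Sum>v\<in>A - {?r} - {s}. \<Sum>f\<in>?F. ?g f v) =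
      (\<Sum>v\<in>A - {?r} - {s}. compose_trees s (add_root_arc T1 v) T2)"
    unfolding compose_trees_def V2
  proof (intro sum.cong refl)
    fix v assume v: "v \<in> A - {?r} - {s}"
    then show "?F = {u. (u, s) \<in> parcs (add_root_arc T1 v)} \<rightarrow>\<^sub>E J"
      by (auto simp: add_root_arc_def)
    fix f assume "f \<in> {u. (u, s) \<in> parcs (add_root_arc T1 v)} \<rightarrow>\<^sub>E J"
    with v have f: "f \<in> ?F" by (auto simp: add_root_arc_def)
    have "add_root_arc (graft s T1 T2 f) v = graft s (add_root_arc T1 v) T2 f"
      unfolding add_root_arc_def root[OF f] unfolding graft_def using v rs by auto
    then show "?g f v = basis_vec (graft s (add_root_arc T1 v) T2 f)" by simp
  qed
  also have "(\<Sum>v\<in>J. \<Sum>f\<in>?F. ?g f v) = compose_trees s (add_root_arc T1 s) T2"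
  proof -
    have rD: "?r \<notin> ?D" using D1(4) by blast
    have "{u. (u, s) \<in> parcs (add_root_arc T1 s)} = insert ?r ?D"
      by (auto simp: add_root_arc_def)
    then have "(compose_trees s (add_root_arc T1 s) T2 :: ('a, 'k) graph_vec) =
        (\<Sum>f\<in>insert ?r ?D \<rightarrow>\<^sub>E J. basis_vec (graft s (add_root_arc T1 s) T2 f))"
      by (simp add: compose_trees_def V2)
    \<comment> \<open>A reconnection of all arcs into \<open>s\<close> is a reconnection
      \<open>f\<close> of the old ones and an end \<open>v\<close> for the new one.\<close>
    also have "\<dots> = (\<Sum>(v, f)\<in>J \<times> ?F. basis_vec (graft s (add_root_arc T1 s) T2 (f(?r := v))))"
      unfolding PiE_insert_eq
      by (subst sum.reindex[OF inj_combinator[OF rD]]) (simp add: case_prod_unfold)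
    also have "\<dots> = (\<Sum>(v, f)\<in>J \<times> ?F. ?g f v)"
    proof (intro sum.cong refl, clarify)
      fix v f assume "v \<in> J" "f \<in> ?F"
      then have "add_root_arc (graft s T1 T2 f) v = graft s (add_root_arc T1 s) T2 (f(?r := v))"
        unfolding add_root_arc_def root[OF \<open>f \<in> ?F\<close>] unfolding graft_def using rs rD by auto
      then show "basis_vec (graft s (add_root_arc T1 s) T2 (f(?r := v))) = ?g f v" by simp
    qed
    finally show ?thesis by (simp add: sum.cartesian_product)
  qed
  also have "(\<Sum>v\<in>A - {?r} - {s}. compose_trees s (add_root_arc T1 v) T2) +
      compose_trees s (add_root_arc T1 s) T2 =
      (\<Sum>v\<in>A - {?r}. compose_trees s (add_root_arc T1 v) T2 :: ('a, 'k) graph_vec)"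
    using s rs D1(1) by (subst sum.remove[of "A - {?r}" s]) (auto simp: add.commute)
  finally show ?thesis
    by (simp add: div0_tree_def lin_ext_sum V1)
qed

text \<open>The two cases for trees combine into one formula by projecting \<open>x\<close> to the
  trees with root \<open>s\<close> in the second term. Both terms apply \<open>compose\<close> to
  graphs with a cycle.\<close>

lemma div0_compose:
  fixes x y :: "('a, 'k::field) graph_vec"
  assumes s: "s \<in> A" and disj: "(A - {s}) \<inter> J = {}" and x: "x \<in> RT A" and y: "y \<in> RT J"
  shows "div0 (compose s x y) = compose s (div0 x) y +
    compose s (lin_ext (\<lambda>T. if tree_root T = s then basis_vec T else 0) x) (div0 y)"
proof -
  let ?C = "\<lambda>T1 T2. lin_ext (\<lambda>G. compose_trees s G T2) (div0_tree T1) :: ('a, 'k) graph_vec"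
  let ?D = "\<lambda>T1 T2. lin_ext (compose_trees s T1) (div0_tree T2) :: ('a, 'k) graph_vec"
  have "div0 (compose s x y) = lin_ext (\<lambda>T1. lin_ext (\<lambda>T2. div0 (compose_trees s T1 T2)) y) x"
    by (simp add: compose_def div0_def lin_ext_lin_ext)
  also have "\<dots> = lin_ext (\<lambda>T1. lin_ext (?C T1) y +
      lin_ext (\<lambda>T2. if tree_root T1 = s then ?D T1 T2 else 0) y) x"
    unfolding lin_ext_fun_add[symmetric]
    by (rule lin_ext_cong[OF x[unfolded RT_def]], rule lin_ext_cong[OF y[unfolded RT_def]])
      (use div0_compose_trees_root[OF _ _ disj] div0_compose_trees_nonroot[OF _ _ s disj]
        in auto)
  also have "\<dots> = lin_ext (\<lambda>T1. lin_ext (?C T1) y) x +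
      lin_ext (\<lambda>T1. lin_ext (\<lambda>T2. if tree_root T1 = s then ?D T1 T2 else 0) y) x"
    by (rule lin_ext_fun_add)
  also have "lin_ext (\<lambda>T1. lin_ext (?C T1) y) x = compose s (div0 x) y"
  proof -
    \<comment> \<open>The sum over \<open>T1\<close> is brought inside to form
      \<open>div0 x\<close>, and then back outside.\<close>
    have "lin_ext (\<lambda>T1. lin_ext (?C T1) y) x = lin_ext (\<lambda>T2. lin_ext (\<lambda>T1. ?C T1 T2) x) y"
      by (rule lin_ext_swap)
    also have "\<dots> = lin_ext (\<lambda>T2. lin_ext (\<lambda>G. compose_trees s G T2) (div0 x)) y"
      by (simp only: div0_def lin_ext_lin_ext)
    also have "\<dots> = compose s (div0 x) y"
      unfolding compose_def by (rule lin_ext_swap)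
    finally show ?thesis .
  qed
  also have "(\<lambda>T1. lin_ext (\<lambda>T2. if tree_root T1 = s then ?D T1 T2 else 0) y) =
      (\<lambda>T1. if tree_root T1 = s then lin_ext (compose_trees s T1) (div0 y) else 0)"
    by (auto simp: div0_def lin_ext_lin_ext)
  also have "lin_ext \<dots> x =
      compose s (lin_ext (\<lambda>T. if tree_root T = s then basis_vec T else 0) x) (div0 y)"
    unfolding compose_def lin_ext_lin_ext
    by (intro arg_cong[of _ _ "\<lambda>f. lin_ext f x"] ext) simp
  finally show ?thesis .
qed

section \<open>The unit and the generators\<close>

lemma two_tree_rooted:
  assumes "a \<noteq> b"
  shows "two_tree a b \<in> rooted_trees {a, b}" "tree_root (two_tree a b) = a"
proof -
  have "rtree {a, b} a {(b, a)}" using assms by (auto simp: rtree_def)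
  from rtree_imp_rooted[OF this]
  show "two_tree a b \<in> rooted_trees {a, b}" "tree_root (two_tree a b) = a"
    by (simp_all add: two_tree_def)
qed

lemma single_vertex_rooted:
  "single_vertex a \<in> rooted_trees {a}" "tree_root (single_vertex a) = a"
proof -
  have "rtree {a} a {}" by (auto simp: rtree_def)
  from rtree_imp_rooted[OF this]
  show "single_vertex a \<in> rooted_trees {a}" "tree_root (single_vertex a) = a"
    by (simp_all add: single_vertex_def)
qed

text \<open>Both trees on two vertices close up to the same two-cycle, so their divergences
  cancel.\<close>

lemma bracket_in_kernel:
  assumes "a \<noteq> b"
  shows "(bracket a b :: ('a, 'k::field) graph_vec) \<in> RT {a, b}"
    "div0 (bracket a b :: ('a, 'k) graph_vec) = 0"
proof -
  have "(basis_vec (two_tree a b) :: ('a, 'k) graph_vec) \<in> RT {a, b}"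
    "(basis_vec (two_tree b a) :: ('a, 'k) graph_vec) \<in> RT {a, b}"
    using two_tree_rooted[OF assms] two_tree_rooted[OF assms[symmetric]]
    by (auto simp: RT_def insert_commute intro!: basis_vec_in_free_space)
  then show "(bracket a b :: ('a, 'k) graph_vec) \<in> RT {a, b}"
    unfolding bracket_def RT_def by (rule pm.subspace_diff[OF free_space_subspace])
  have "(div0_tree (two_tree a b) :: ('a, 'k) graph_vec) =
      basis_vec (digraph_of {a, b} {(a, b), (b, a)})" if "a \<noteq> b" for a b
  proof -
    have "{a, b} - {a} = {b}" using that by auto
    then show ?thesis
      unfolding div0_tree_def two_tree_rooted(2)[OF that] add_root_arc_def
      by (simp add: two_tree_def)
  qed
  from this[OF assms] this[OF assms[symmetric]]
  show "div0 (bracket a b :: ('a, 'k) graph_vec) = 0"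
    by (simp add: div0_def bracket_def lin_ext_diff insert_commute)
qed

lemma suboperadD:
  assumes "suboperad P" "finite I"
  shows "P I \<subseteq> RT I" "pm.subspace (P I)"
    "bij_betw \<sigma> I J \<Longrightarrow> x \<in> P I \<Longrightarrow> relabel \<sigma> x \<in> P J"
    "basis_vec (single_vertex a) \<in> P {a}"
    "finite J \<Longrightarrow> s \<in> I \<Longrightarrow> (I - {s}) \<inter> J = {} \<Longrightarrow> x \<in> P I \<Longrightarrow> y \<in> P J \<Longrightarrow>
      compose s x y \<in> P ((I - {s}) \<union> J)"
  using assms unfolding suboperad_def by simp_all

lemma suboperad_div0_kernel:
  "suboperad (\<lambda>I. {x \<in> RT I. div0 x = 0} :: ('a, 'k::field) graph_vec set)"
  unfolding suboperad_def
proof (intro conjI allI impI ballI)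
  fix I :: "'a set"
  assume "finite I"
  have "pm.subspace (RT I :: ('a, 'k) graph_vec set)"
    unfolding RT_def by (rule free_space_subspace)
  then show "pm.subspace {x \<in> RT I. div0 (x :: ('a, 'k) graph_vec) = 0}"
    by (simp add: pm.subspace_def div0_def lin_ext_add lin_ext_scale)
next
  fix I J :: "'a set" and \<sigma> and x :: "('a, 'k) graph_vec"
  assume *: "finite I" "bij_betw \<sigma> I J" "x \<in> {x \<in> RT I. div0 x = 0}"
  then have x: "x \<in> RT I" "div0 x = 0" by simp_all
  have "relabel \<sigma> x \<in> RT J" by (rule suboperadD(3)[OF suboperad_RT *(1,2) x(1)])
  moreover have "div0 (relabel \<sigma> x) = 0"
    unfolding div0_relabel[OF x(1) *(2)] x(2) by (simp add: relabel_def)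
  ultimately show "relabel \<sigma> x \<in> {x \<in> RT J. div0 x = 0}" by simp
next
  fix a :: 'a
  have "(basis_vec (single_vertex a) :: ('a, 'k) graph_vec) \<in> RT {a}"
    unfolding RT_def by (intro basis_vec_in_free_space single_vertex_rooted(1))
  moreover have "div0 (basis_vec (single_vertex a) :: ('a, 'k) graph_vec) = 0"
    unfolding div0_def lin_ext_basis_vec div0_tree_def single_vertex_rooted(2)
    by (simp add: single_vertex_def)
  ultimately show
    "(basis_vec (single_vertex a) :: ('a, 'k) graph_vec) \<in> {x \<in> RT {a}. div0 x = 0}" by simp
next
  fix A J :: "'a set" and s and x y :: "('a, 'k) graph_vec"
  assume *: "finite A" "finite J" "s \<in> A" "(A - {s}) \<inter> J = {}"
    and "x \<in> {x \<in> RT A. div0 x = 0}" "y \<in> {x \<in> RT J. div0 x = 0}"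
  then have x: "x \<in> RT A" "div0 x = 0" and y: "y \<in> RT J" "div0 y = 0" by simp_all
  have "compose s x y \<in> RT (A - {s} \<union> J)"
    by (rule suboperadD(5)[OF suboperad_RT * x(1) y(1)])
  moreover have "div0 (compose s x y) = 0"
    unfolding div0_compose[OF *(3,4) x(1) y(1)] x(2) y(2) by (simp add: compose_def)
  ultimately show "compose s x y \<in> {x \<in> RT (A - {s} \<union> J). div0 x = 0}" by simp
next
  show "{x \<in> RT I. div0 x = 0} \<subseteq> RT I" for I :: "'a set"
    by simp
qed

section \<open>Iterated brackets\<close>

lemma tree_root_chain:
  assumes "distinct rs" "rs \<noteq> []"
  shows "tree_root (digraph_of (set rs) (chain rs)) = hd rs"
  by (rule rtree_imp_rooted(2)[OF rtree_chain[OF assms]])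

text \<open>One term of the bracket puts \<open>b\<close> as a new root below the root of each tree
  of \<open>y\<close>; the other attaches \<open>b\<close> as a leaf, which never gives a chain
  whose leaf is in \<open>J\<close>. So only chains with root \<open>b\<close> occur, with the
  coefficient of the chain that remains without \<open>b\<close>.\<close>

lemma lookup_compose_bracket_chain:
  fixes y :: "('a, 'k::field) graph_vec"
  assumes y: "y \<in> RT J" and c: "c \<in> J" and b: "b \<notin> J"
    and dist: "distinct (b' # c' # rs)" and V: "set (b' # c' # rs) = insert b J"
    and last: "last (c' # rs) \<in> J"
  shows "Poly_Mapping.lookup (compose c (bracket b c) y)
      (digraph_of (insert b J) (chain (b' # c' # rs))) =
    (if b = b' then Poly_Mapping.lookup y (digraph_of J (chain (c' # rs))) else 0)"
proof -
  let ?S = "digraph_of (insert b J) (chain (b' # c' # rs))"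
  let ?T = "digraph_of J (chain (c' # rs))"
  let ?p = "\<lambda>T. digraph_of (insert b J) (insert (tree_root T, b) (parcs T))"
  have bc: "b \<noteq> c" using b c by blast
  have up: "(compose_trees c (two_tree b c) T :: ('a, 'k) graph_vec) = basis_vec (?p T)"
    if T: "T \<in> rooted_trees J" for T
  proof -
    have "{u. (u, c) \<in> parcs (two_tree b c)} = {}" using bc by (auto simp: two_tree_def)
    moreover have "graft c (two_tree b c) T f = ?p T" for f
      using T bc by (auto simp: graft_def two_tree_def rooted_trees_def)
    ultimately show ?thesis by (simp add: compose_trees_def)
  qed
  \<comment> \<open>Here no arc ends at \<open>b\<close>, whereas in the chain one does, as
    \<open>b\<close> is not its last entry.\<close>
  have down: "Poly_Mapping.lookup (compose_trees c (two_tree c b) T :: ('a, 'k) graph_vec) ?S = 0"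
    if T: "T \<in> rooted_trees J" for T
  proof -
    have TJ: "parcs T \<subseteq> J \<times> J" "pverts T = J"
      using T by (auto simp: rooted_trees_iff rtree_def)
    have "b \<in> set (butlast (b' # c' # rs))"
    proof -
      have "b \<noteq> last (b' # c' # rs)" using last b by auto
      moreover have "b \<in> set (b' # c' # rs)" unfolding V by simp
      moreover have "set xs = insert (last xs) (set (butlast xs))" if "xs \<noteq> []" for xs :: "'a list"
        using that by (induction xs) auto
      then have "set (b' # c' # rs) = insert (last (b' # c' # rs)) (set (butlast (b' # c' # rs)))"
        by blast
      ultimately show ?thesis by blast
    qed
    then have "b \<in> snd ` chain (b' # c' # rs)" by (simp only: chain_ran)
    then obtain u where u: "(u, b) \<in> chain (b' # c' # rs)" by (elim imageE) (metis prod.collapse)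
    have "graft c (two_tree c b) T f \<noteq> ?S"
      if "f \<in> {u. (u, c) \<in> parcs (two_tree c b)} \<rightarrow>\<^sub>E pverts T" for f
    proof
      assume "graft c (two_tree c b) T f = ?S"
      then have "(u, b) \<in> parcs (graft c (two_tree c b) T f)"
        using u by (simp only: pair_pre_digraph.select_convs)
      moreover have "f b \<in> J" using that TJ by (auto simp: two_tree_def PiE_def Pi_def)
      ultimately show False using TJ b bc by (auto simp: graft_def two_tree_def)
    qed
    then show ?thesis
      unfolding compose_trees_def lookup_sum
      by (intro sum.neutral) (auto simp: lookup_single when_def)
  qed
  \<comment> \<open>In \<open>?p T\<close> no arc leaves \<open>b\<close>, so \<open>b\<close> must
    head the chain; removing the arc into \<open>b\<close> recovers \<open>T\<close>.\<close>
  have S_eq: "?p T = ?S \<longleftrightarrow> b = b' \<and> T = ?T" if T: "T \<in> rooted_trees J" for T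
  proof
    have TJ: "parcs T \<subseteq> J \<times> J" "pverts T = J"
      using T by (auto simp: rooted_trees_iff rtree_def)
    assume "?p T = ?S"
    then have arcs: "insert (tree_root T, b) (parcs T) = chain (b' # c' # rs)"
      by (simp only: pair_pre_digraph.ext_inject)
    have nb: "(b, v) \<notin> parcs T" "(v, b) \<notin> parcs T" for v using TJ b by auto
    have "tree_root T \<noteq> b" using T b by (auto simp: rooted_trees_iff rtree_def)
    then have "b \<notin> fst ` chain (b' # c' # rs)" unfolding arcs[symmetric] using nb by auto
    then have "b \<notin> set (c' # rs)" unfolding chain_dom by simp
    moreover have "b \<in> set (b' # c' # rs)" unfolding V by simp
    ultimately have bb: "b = b'" by simp
    have "snd ` chain (c' # rs) \<subseteq> set (c' # rs)"
      unfolding chain_ran by (auto dest: in_set_butlastD)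
    moreover have "b' \<notin> set (c' # rs)" using dist by simp
    ultimately have "(v, b') \<notin> chain (c' # rs)" for v by force
    moreover have "insert (tree_root T, b') (parcs T) = insert (c', b') (chain (c' # rs))"
      using arcs bb by simp
    ultimately have "parcs T = chain (c' # rs)"
      using nb(2)[unfolded bb] by (intro set_eqI) (metis insert_iff surj_pair)
    then show "b = b' \<and> T = ?T" using bb TJ(2) by simp
  next
    assume *: "b = b' \<and> T = ?T"
    have "b' \<notin> set (c' # rs)" using dist by simp
    moreover have "insert b' (set (c' # rs)) = insert b J" using V by (simp only: list.set)
    ultimately have "J = set (c' # rs)" using b * by (metis insert_ident)
    then have "tree_root ?T = c'" using tree_root_chain[of "c' # rs"] dist by simp
    then show "?p T = ?S" using * by simp
  qed
  have K: "T \<in> rooted_trees J" if "T \<in> Poly_Mapping.keys y" for T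
    using y that by (auto simp: RT_def free_space_def)
  have "compose c (bracket b c) y =
      lin_ext (\<lambda>T. basis_vec (?p T)) y - lin_ext (compose_trees c (two_tree c b)) y"
    unfolding compose_def bracket_def lin_ext_diff lin_ext_basis_vec
    using lin_ext_cong[OF y[unfolded RT_def] up] by simp
  then have "Poly_Mapping.lookup (compose c (bracket b c) y) ?S =
      (\<Sum>T\<in>Poly_Mapping.keys y. Poly_Mapping.lookup y T *
        Poly_Mapping.lookup (basis_vec (?p T) :: ('a, 'k) graph_vec) ?S) -
      (\<Sum>T\<in>Poly_Mapping.keys y. Poly_Mapping.lookup y T *
        Poly_Mapping.lookup (compose_trees c (two_tree c b) T :: ('a, 'k) graph_vec) ?S)"
    by (simp only: lookup_minus lookup_lin_ext)
  also have "(\<Sum>T\<in>Poly_Mapping.keys y. Poly_Mapping.lookup y T *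
      Poly_Mapping.lookup (compose_trees c (two_tree c b) T :: ('a, 'k) graph_vec) ?S) = 0"
    by (intro sum.neutral ballI) (simp only: down[OF K] mult_zero_right)
  also have "(\<Sum>T\<in>Poly_Mapping.keys y. Poly_Mapping.lookup y T *
      Poly_Mapping.lookup (basis_vec (?p T) :: ('a, 'k) graph_vec) ?S) =
      (\<Sum>T\<in>Poly_Mapping.keys y. if b = b' \<and> T = ?T then Poly_Mapping.lookup y T else 0)"
    by (intro sum.cong refl) (simp only: lookup_single when_def S_eq[OF K], simp)
  also have "\<dots> - 0 = (if b = b' then Poly_Mapping.lookup y ?T else 0)"
    by (cases "b = b'") (auto simp: in_keys_iff)
  finally show ?thesis .
qed

text \<open>The right-normed bracket of the entries. The label \<open>c\<close> serves both as the
  slot of the outer bracket and as a label of the inner word, so no fresh label is required.\<close>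

fun lie_word :: "'a list \<Rightarrow> ('a, 'k::field) graph_vec" where
  "lie_word [] = 0"
| "lie_word [a] = basis_vec (single_vertex a)"
| "lie_word (b # c # rs) = compose c (bracket b c) (lie_word (c # rs))"

text \<open>Stated for any suboperad with the brackets, to serve both for the kernel and for the
  members of the intersection that defines \<open>Lie\<close>.\<close>

lemma lie_word_in_suboperad:
  assumes P: "suboperad P" and br: "\<And>a b. a \<noteq> b \<Longrightarrow> bracket a b \<in> P {a, b}"
    and "distinct rs" "rs \<noteq> []"
  shows "(lie_word rs :: ('a, 'k::field) graph_vec) \<in> P (set rs)"
  using assms(3,4)
proof (induction rs rule: lie_word.induct)
  case (2 a)
  show ?case using suboperadD(4)[OF P finite.emptyI] by simp
next
  case (3 b c rs)
  then have IH: "lie_word (c # rs) \<in> P (set (c # rs))" and "b \<noteq> c" "b \<notin> set (c # rs)" by auto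
  then have disj: "({b, c} - {c}) \<inter> set (c # rs) = {}"
    and V: "({b, c} - {c}) \<union> set (c # rs) = set (b # c # rs)" by auto
  have "compose c (bracket b c) (lie_word (c # rs)) \<in> P (({b, c} - {c}) \<union> set (c # rs))"
    by (rule suboperadD(5)[OF P _ _ _ disj br[OF \<open>b \<noteq> c\<close>] IH]) simp_all
  then show ?case unfolding V by simp
qed simp

lemma lie_word_in_kernel:
  assumes "distinct rs" "rs \<noteq> []"
  shows "(lie_word rs :: ('a, 'k::field) graph_vec) \<in> RT (set rs)"
    "div0 (lie_word rs :: ('a, 'k) graph_vec) = 0"
proof -
  have "(lie_word rs :: ('a, 'k) graph_vec) \<in> {x \<in> RT (set rs). div0 x = 0}"
    by (rule lie_word_in_suboperad[OF suboperad_div0_kernel _ assms])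
      (simp add: bracket_in_kernel)
  then show "(lie_word rs :: ('a, 'k) graph_vec) \<in> RT (set rs)"
    "div0 (lie_word rs :: ('a, 'k) graph_vec) = 0" by simp_all
qed

text \<open>Words and chains with a common last entry are dual to each other: each step of the
  induction compares the outermost letter with the root of the chain and removes both.\<close>

lemma lookup_lie_word_chain:
  assumes "distinct rs" "rs \<noteq> []" "distinct rs'" "set rs' = set rs" "last rs' = last rs"
  shows "Poly_Mapping.lookup (lie_word rs :: ('a, 'k::field) graph_vec)
      (digraph_of (set rs) (chain rs')) = (if rs = rs' then 1 else 0)"
  using assms
proof (induction rs arbitrary: rs' rule: lie_word.induct)
  case (2 a)
  then have "length rs' = length [a]" by (metis distinct_card)
  then obtain a' where "rs' = [a']" by (auto simp: length_Suc_conv)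
  then have "rs' = [a]" using 2(4) by simp
  then show ?case by (simp add: single_vertex_def)
next
  case (3 b c rs)
  then have "length rs' = length (b # c # rs)" by (metis distinct_card)
  then obtain b' c' rs'' where rs': "rs' = b' # c' # rs''" by (auto simp: length_Suc_conv)
  note dist' = 3(4)[unfolded rs']
  have b: "b \<notin> set (c # rs)" and d: "distinct (c # rs)" using 3(2) by simp_all
  have y: "(lie_word (c # rs) :: ('a, 'k) graph_vec) \<in> RT (set (c # rs))"
    using lie_word_in_kernel(1)[OF d] by simp
  have l: "last (c' # rs'') = last (c # rs)" using 3(6) rs' by simp
  then have lJ: "last (c' # rs'') \<in> set (c # rs)" by (metis last_in_set list.distinct(1))
  have V: "set (b' # c' # rs'') = insert b (set (c # rs))"
    using 3(5) unfolding rs' by (simp only: list.set)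
  have "Poly_Mapping.lookup (lie_word (b # c # rs) :: ('a, 'k) graph_vec)
      (digraph_of (insert b (set (c # rs))) (chain (b' # c' # rs''))) =
    (if b = b' then Poly_Mapping.lookup (lie_word (c # rs) :: ('a, 'k) graph_vec)
      (digraph_of (set (c # rs)) (chain (c' # rs''))) else 0)"
    unfolding lie_word.simps
    by (rule lookup_compose_bracket_chain[OF y _ b dist' V lJ]) simp
  also have "\<dots> = (if b # c # rs = rs' then 1 else 0)"
  proof (cases "b = b'")
    case True
    have "b \<notin> set (c' # rs'')" using dist' True by simp
    moreover have "insert b (set (c' # rs'')) = insert b (set (c # rs))"
      using V True by (simp only: list.set)
    ultimately have "set (c' # rs'') = set (c # rs)" using b by (metis insert_ident)
    moreover have "distinct (c' # rs'')" using dist' by simp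
    ultimately have "Poly_Mapping.lookup (lie_word (c # rs) :: ('a, 'k) graph_vec)
        (digraph_of (set (c # rs)) (chain (c' # rs''))) = (if c # rs = c' # rs'' then 1 else 0)"
      by (intro 3(1) d l) simp_all
    then show ?thesis using True rs' by simp
  next
    case False
    then show ?thesis using rs' by simp
  qed
  finally show ?case using rs' by (simp only: list.set)
qed simp

theorem theorem5p2:
  fixes I :: "'a set"
  assumes "finite I"
  shows "{x \<in> RT I. div0 x = 0} = (Lie I :: ('a, 'k::field_char_0) graph_vec set)"
proof
  show "Lie I \<subseteq> {x \<in> RT I. div0 (x :: ('a, 'k) graph_vec) = 0}"
    unfolding Lie_def generated_suboperad_def
    \<comment> \<open>The kernel is itself one of the suboperads in the intersection.\<close>
    by (rule Inter_lower, rule CollectI, rule exI[of _ "\<lambda>I. {x \<in> RT I. div0 x = 0}"])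
      (auto simp: suboperad_div0_kernel bracket_in_kernel)
  show "{x \<in> RT I. div0 (x :: ('a, 'k) graph_vec) = 0} \<subseteq> Lie I"
  proof
    fix x :: "('a, 'k) graph_vec"
    assume "x \<in> {x \<in> RT I. div0 x = 0}"
    then have x: "x \<in> RT I" "div0 x = 0" by auto
    have "x \<in> P I" if P: "suboperad P" and br: "\<And>a b. a \<noteq> b \<Longrightarrow> bracket a b \<in> P {a, b}" for P
    proof -
      have sub: "pm.subspace (P I)" by (rule suboperadD(2)[OF P assms])
      show ?thesis
      proof (cases "I = {}")
        case True
        then have "rooted_trees I = {}" by (auto simp: rooted_trees_iff rtree_def)
        then have "x = 0" using x(1) by (simp add: RT_def free_space_def)
        then show ?thesis using sub by (simp add: pm.subspace_0)
      next
        case False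
        then obtain a where a: "a \<in> I" by blast
        \<comment> \<open>The orderings of \<open>I\<close> ending at a fixed vertex
          \<open>a\<close>; \<open>z\<close> is the combination of their words that agrees with
          \<open>x\<close> on all chains with leaf \<open>a\<close>.\<close>
        define W where "W = {rs. distinct rs \<and> set rs = I \<and> last rs = a}"
        define c where "c rs = Poly_Mapping.lookup x (digraph_of I (chain rs))" for rs
        define z where "z = (\<Sum>rs\<in>W. pm_scale (c rs) (lie_word rs))"
        have finW: "finite W"
          by (rule finite_subset[OF _ finite_subset_distinct[OF assms]]) (auto simp: W_def)
        have W: "distinct rs" "rs \<noteq> []" "set rs = I" "last rs = a" if "rs \<in> W" for rs
          using that False by (auto simp: W_def)
        have z_in: "z \<in> Q I" if "suboperad Q" "\<And>a b. a \<noteq> b \<Longrightarrow> bracket a b \<in> Q {a, b}" for Q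
        proof -
          have Q: "pm.subspace (Q I)" by (rule suboperadD(2)[OF that(1) assms])
          show ?thesis unfolding z_def
          proof (rule pm.subspace_sum[OF Q], rule pm.subspace_scale[OF Q])
            fix rs assume "rs \<in> W"
            then show "lie_word rs \<in> Q I"
              using lie_word_in_suboperad[OF that W(1,2)] W(3) by metis
          qed
        qed
        have "z \<in> {x \<in> RT I. div0 x = 0}"
          by (rule z_in[OF suboperad_div0_kernel]) (simp add: bracket_in_kernel)
        then have z: "z \<in> RT I" "div0 z = 0" by simp_all
        \<comment> \<open>The difference lies in the kernel and vanishes on these chains, hence is
          zero; so \<open>x\<close> lies in every \<open>P I\<close> that contains
          \<open>z\<close>.\<close>
        have "x - z = 0"
        proof (rule div0_zero_eq_0I[OF _ _ a])
          show "x - z \<in> RT I"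
            using x(1) z(1) unfolding RT_def by (rule pm.subspace_diff[OF free_space_subspace])
          show "div0 (x - z) = 0" using x(2) z(2) by (simp add: div0_def lin_ext_diff)
          fix rs assume rs: "distinct rs" "set rs = I" "last rs = a"
          then have rsW: "rs \<in> W" by (simp add: W_def)
          have "Poly_Mapping.lookup z (digraph_of I (chain rs)) =
              (\<Sum>rs'\<in>W. if rs' = rs then c rs' else 0)"
            unfolding z_def lookup_sum lookup_pm_scale
          proof (intro sum.cong refl)
            fix rs' assume "rs' \<in> W"
            then show "c rs' * Poly_Mapping.lookup (lie_word rs') (digraph_of I (chain rs)) =
                (if rs' = rs then c rs' else 0)"
              using lookup_lie_word_chain[of rs' rs, where 'k = 'k] W[of rs'] rs by simp
          qed
          also have "\<dots> = c rs" using finW rsW by simp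
          finally show "Poly_Mapping.lookup (x - z) (digraph_of I (chain rs)) = 0"
            by (simp add: lookup_minus c_def)
        qed
        then show ?thesis using z_in[OF P br] by simp
      qed
    qed
    then show "x \<in> Lie I"
      unfolding Lie_def generated_suboperad_def by blast
  qed
qed

end
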